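(* Suppose $n\neq2$. Then $V^+$ is a representation of $Z_n\otimes\mathrm{Cl}(\eta)^{\mathrm{op}}$ (with $Z_n$ acting on the left and $\mathrm{Cl}(\eta)^{\mathrm{op}}$ acting by right multiplication), whose irreducible subrepresentations correspond to those of the regular representation of the Clifford algebra $\mathrm{Cl}(\eta)$. In particular, when $n$ is even, $V^+$ is an irreducible representation of $Z_n\otimes\mathrm{Cl}(\eta)^{\mathrm{op}}$.
   Context: Fix $n\ge1$ and an invertible complex matrix $\eta=(\eta^{ij})$ with $\eta^{ij}=\eta^{ji}$ and inverse $(\eta_{ij})$. $\mathrm{Cl}(\eta)$ is the Clifford algebra generated by $\gamma^1,\dots,\gamma^n$ with $\gamma^i\gamma^j+\gamma^j\gamma^i=2\eta^{ij}$. $\mathcal{A}=W(2n|n)$ is the associative superalgebra generated by even $x^1,\dots,x^n,\partial_1,\dots,\partial_n$ and odd $\gamma^1,\dots,\gamma^n$ with relations $x^ix^j=x^jx^i$, $\partial_i\partial_j=\partial_j\partial_i$, $\partial_ix^j-x^j\partial_i=\delta_i^j$, $\gamma^i$ commuting with $x^j,\partial_j$, and the Clifford relations. Repeated indices are summed; $\partial^i=\eta^{ij}\partial_j$. $\mathcal{A}$ acts on $V=\mathrm{Cl}(\eta)\otimes\mathbb{C}[x^1,\dots,x^n]$ ($x^i,\gamma^i$ by left multiplication, $\partial_i$ by $\partial/\partial x^i$). $X=\frac{\sqrt{-1}}{\sqrt2}\gamma^i\partial_i$, $E=-\frac12\partial^i\partial_i$, and $V^+=\{v\in V:Xv=0\}$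 is the space of Clifford-valued polynomial solutions of the massless Dirac equation. $I=\mathcal{A}X+\mathcal{A}E$, and the reduction algebra is $Z_n=N_{\mathcal{A}}(I)/I$ with $N_{\mathcal{A}}(I)=\{a\in\mathcal{A}:Ia\subset I\}$; it acts on $V^+$ by left action of representatives. *)

theory Defs
  imports Complex_Main
begin

text \<open>
Concrete model.  The Clifford algebra Cl(eta) is an abstract ring 'c together with
a central embedding sc of the scalars and generators gam 0..n-1 satisfying the
Clifford relations, such that the ordered monomials form a C-basis (this
characterises Cl(eta) up to isomorphism).
V = Cl(eta) tensor C[x_0..x_{n-1}] is modelled as finitely supported functions
from exponent vectors (nat => nat, zero outside {..<n}) to 'c.
The superalgebra A = W(2n|n) is modelled, via its faithful action on V, as the
algebra of operators generated by x^i, d_i, left multiplication by gam i and scalars.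
\<close>

definition clmono :: "(nat \<Rightarrow> 'c::ring_1) \<Rightarrow> nat set \<Rightarrow> 'c" where
  "clmono gam S = foldr (\<lambda>i acc. gam i * acc) (sorted_list_of_set S) 1"

definition is_Cl :: "nat \<Rightarrow> (nat \<Rightarrow> nat \<Rightarrow> complex) \<Rightarrow> (complex \<Rightarrow> 'c::ring_1)
    \<Rightarrow> (nat \<Rightarrow> 'c) \<Rightarrow> bool" where
  "is_Cl n eta sc gam \<longleftrightarrow>
     (\<forall>a b. sc (a + b) = sc a + sc b) \<and> (\<forall>a b. sc (a * b) = sc a * sc b) \<and> sc 1 = 1 \<and>
     (\<forall>a c. sc a * c = c * sc a) \<and>
     (\<forall>i<n. \<forall>j<n. gam i * gam j + gam j * gam i = sc (2 * eta i j)) \<and>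
     (\<forall>c. \<exists>!k. (\<forall>S. S \<notin> Pow {..<n} \<longrightarrow> k S = 0) \<and>
               c = (\<Sum>S\<in>Pow {..<n}. sc (k S) * clmono gam S))"

definition Vsp :: "nat \<Rightarrow> ((nat \<Rightarrow> nat) \<Rightarrow> 'c::zero) set" where
  "Vsp n = {f. finite {\<alpha>. f \<alpha> \<noteq> 0} \<and> (\<forall>\<alpha>. f \<alpha> \<noteq> 0 \<longrightarrow> (\<forall>i\<ge>n. \<alpha> i = 0))}"

definition xop :: "nat \<Rightarrow> ((nat \<Rightarrow> nat) \<Rightarrow> 'c::ring_1) \<Rightarrow> ((nat \<Rightarrow> nat) \<Rightarrow> 'c)" where
  "xop i f = (\<lambda>\<alpha>. if 0 < \<alpha> i then f (\<alpha>(i := \<alpha> i - 1)) else 0)"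

definition dop :: "nat \<Rightarrow> ((nat \<Rightarrow> nat) \<Rightarrow> 'c::ring_1) \<Rightarrow> ((nat \<Rightarrow> nat) \<Rightarrow> 'c)" where
  "dop i f = (\<lambda>\<alpha>. of_nat (Suc (\<alpha> i)) * f (\<alpha>(i := Suc (\<alpha> i))))"

definition lop :: "'c::ring_1 \<Rightarrow> ((nat \<Rightarrow> nat) \<Rightarrow> 'c) \<Rightarrow> ((nat \<Rightarrow> nat) \<Rightarrow> 'c)" where
  "lop c f = (\<lambda>\<alpha>. c * f \<alpha>)"

definition rop :: "'c::ring_1 \<Rightarrow> ((nat \<Rightarrow> nat) \<Rightarrow> 'c) \<Rightarrow> ((nat \<Rightarrow> nat) \<Rightarrow> 'c)" where
  "rop c f = (\<lambda>\<alpha>. f \<alpha> * c)"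

definition const :: "'c::zero \<Rightarrow> ((nat \<Rightarrow> nat) \<Rightarrow> 'c)" where
  "const c = (\<lambda>\<alpha>. if \<alpha> = (\<lambda>_. 0) then c else 0)"

type_synonym 'c op = "((nat \<Rightarrow> nat) \<Rightarrow> 'c) \<Rightarrow> ((nat \<Rightarrow> nat) \<Rightarrow> 'c)"

inductive_set WC :: "nat \<Rightarrow> (complex \<Rightarrow> 'c::ring_1) \<Rightarrow> (nat \<Rightarrow> 'c) \<Rightarrow> 'c op set"
  for n sc gam where
  WC_id: "id \<in> WC n sc gam"
| WC_x: "i < n \<Longrightarrow> xop i \<in> WC n sc gam"
| WC_d: "i < n \<Longrightarrow> dop i \<in> WC n sc gam"
| WC_g: "i < n \<Longrightarrow> lop (gam i) \<in> WC n sc gam"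
| WC_scal: "a \<in> WC n sc gam \<Longrightarrow> lop (sc z) \<circ> a \<in> WC n sc gam"
| WC_add: "a \<in> WC n sc gam \<Longrightarrow> b \<in> WC n sc gam \<Longrightarrow> (\<lambda>f \<alpha>. a f \<alpha> + b f \<alpha>) \<in> WC n sc gam"
| WC_comp: "a \<in> WC n sc gam \<Longrightarrow> b \<in> WC n sc gam \<Longrightarrow> a \<circ> b \<in> WC n sc gam"

definition Xop :: "nat \<Rightarrow> (complex \<Rightarrow> 'c::ring_1) \<Rightarrow> (nat \<Rightarrow> 'c) \<Rightarrow> 'c op" where
  "Xop n sc gam f = (\<lambda>\<alpha>. \<Sum>i<n. sc (\<i> / complex_of_real (sqrt 2)) * (gam i * dop i f \<alpha>))"

definition Eop :: "nat \<Rightarrow> (nat \<Rightarrow> nat \<Rightarrow> complex) \<Rightarrow> (complex \<Rightarrow> 'c::ring_1) \<Rightarrow> 'c op" where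
  "Eop n eta sc f = (\<lambda>\<alpha>. sc (- 1 / 2) * (\<Sum>i<n. \<Sum>j<n. sc (eta i j) * dop i (dop j f) \<alpha>))"

definition Iid :: "nat \<Rightarrow> (nat \<Rightarrow> nat \<Rightarrow> complex) \<Rightarrow> (complex \<Rightarrow> 'c::ring_1) \<Rightarrow> (nat \<Rightarrow> 'c) \<Rightarrow> 'c op set" where
  "Iid n eta sc gam = {a \<in> WC n sc gam. \<exists>b\<in>WC n sc gam. \<exists>c\<in>WC n sc gam.
      \<forall>f\<in>Vsp n. a f = (\<lambda>\<alpha>. b (Xop n sc gam f) \<alpha> + c (Eop n eta sc f) \<alpha>)}"

definition Nrm :: "nat \<Rightarrow> (nat \<Rightarrow> nat \<Rightarrow> complex) \<Rightarrow> (complex \<Rightarrow> 'c::ring_1) \<Rightarrow> (nat \<Rightarrow> 'c) \<Rightarrow> 'c op set" where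
  "Nrm n eta sc gam = {a \<in> WC n sc gam. \<forall>i\<in>Iid n eta sc gam. i \<circ> a \<in> Iid n eta sc gam}"

definition Vplus :: "nat \<Rightarrow> (complex \<Rightarrow> 'c::ring_1) \<Rightarrow> (nat \<Rightarrow> 'c) \<Rightarrow> ((nat \<Rightarrow> nat) \<Rightarrow> 'c) set" where
  "Vplus n sc gam = {f \<in> Vsp n. Xop n sc gam f = (\<lambda>_. 0)}"

text \<open>Subrepresentations of V^+ for Z_n (tensor) Cl(eta)^op: C-subspaces of V^+ stable under the
  action of (representatives in) N_A(I) and under right multiplication by Cl(eta).\<close>
definition subrep :: "nat \<Rightarrow> (nat \<Rightarrow> nat \<Rightarrow> complex) \<Rightarrow> (complex \<Rightarrow> 'c::ring_1) \<Rightarrow> (nat \<Rightarrow> 'c)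
    \<Rightarrow> ((nat \<Rightarrow> nat) \<Rightarrow> 'c) set \<Rightarrow> bool" where
  "subrep n eta sc gam W \<longleftrightarrow> W \<subseteq> Vplus n sc gam \<and> (\<lambda>_. 0) \<in> W \<and>
     (\<forall>f\<in>W. \<forall>g\<in>W. (\<lambda>\<alpha>. f \<alpha> + g \<alpha>) \<in> W) \<and> (\<forall>z. \<forall>f\<in>W. lop (sc z) f \<in> W) \<and>
     (\<forall>a\<in>Nrm n eta sc gam. \<forall>f\<in>W. a f \<in> W) \<and> (\<forall>c. \<forall>f\<in>W. rop c f \<in> W)"

definition irred_subrep :: "nat \<Rightarrow> (nat \<Rightarrow> nat \<Rightarrow> complex) \<Rightarrow> (complex \<Rightarrow> 'c::ring_1) \<Rightarrow> (nat \<Rightarrow> 'c)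
    \<Rightarrow> ((nat \<Rightarrow> nat) \<Rightarrow> 'c) set \<Rightarrow> bool" where
  "irred_subrep n eta sc gam W \<longleftrightarrow> subrep n eta sc gam W \<and> W \<noteq> {\<lambda>_. 0} \<and>
     (\<forall>U. subrep n eta sc gam U \<and> U \<subseteq> W \<longrightarrow> U = {\<lambda>_. 0} \<or> U = W)"

text \<open>Subrepresentations of the regular representation of Cl(eta) (as Cl(eta) tensor Cl(eta)^op-module,
  i.e. two-sided ideals) and the irreducible ones (minimal nonzero two-sided ideals).\<close>
definition cl_subrep :: "'c::ring_1 set \<Rightarrow> bool" where
  "cl_subrep J \<longleftrightarrow> 0 \<in> J \<and> (\<forall>x\<in>J. \<forall>y\<in>J. x + y \<in> J) \<and> (\<forall>a b. \<forall>x\<in>J. a * x * b \<in> J)"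

definition cl_irred :: "'c::ring_1 set \<Rightarrow> bool" where
  "cl_irred J \<longleftrightarrow> cl_subrep J \<and> J \<noteq> {0} \<and> (\<forall>J'. cl_subrep J' \<and> J' \<subseteq> J \<longrightarrow> J' = {0} \<or> J' = J)"

end

(* Write D = gam^i d_i, y = gam_i x^i and H for the Euler operator.  X is a multiple of D and E = X^2,
   so an operator a lies in N_A(I) as soon as D a = b D for some b in the algebra.  This holds for
   d_i, for gam^i (2 H + n - 2) - 2 y d^i, and for x^i (2 H + n) - y gam^i - y y d^i, because
   D y + y D = 2 H + n.  The d_i bring every nonzero subrepresentation W down to nonzero constants; the
   second family acts on constants as (n - 2) gam^i, so for n <> 2 the constants of W form a two-sided
   ideal.  Minimal subrepresentations are recovered from their constants, which gives the bijection.
   The third family satisfies sum_i (x^i (2 H + n) - y gam^i - y y d^i) d_i f = d (2 d + n - 2) f on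
   homogeneous f in V^+ of degree d, so V^+ is generated by the constants, and for even n the Clifford
   algebra is simple. *)
theory Submission
  imports Defs "HOL-Library.Function_Algebras"
begin

section \<open>Operators on Clifford-valued polynomials\<close>

text \<open>The normalizer is never computed. Stability of a solution space under all of it follows
  abstractly, because the ideal annihilates \<open>Vplus\<close> and the algebra acts on
  coefficients by left multiplication; in the other direction the three explicit families already
  suffice. They are written with denominators cleared, and the price is scalar factors that must be
  shown to be nonzero: n - 2 on constants and d (2 d + n - 2) in degree d. The ideal of constants is
  not shown to determine a general subrepresentation, so the correspondence is argued on minimal
  ones only. Two auxiliary subrepresentations carry it: the solutions with all coefficients in an
  ideal J, which bound from above, and the one generated by the constants in J. Simplicity for even
  n needs a change of basis: \<open>eta\<close> is an arbitrary symmetric matrix, so monomials in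
  the given generators need not be eigenvectors of conjugation by a generator. An orthonormal basis
  of their span repairs this; it comes from a maximality argument that works for the bilinear form
  as it stands.\<close>

lemma sum_fun_eval: "sum F A x = (\<Sum>i\<in>A. F i x)"
  for F :: "'i \<Rightarrow> 'x \<Rightarrow> 'y::comm_monoid_add"
  by (induction A rule: infinite_finite_induct) auto

interpretation xop: additive "xop i :: ((nat \<Rightarrow> nat) \<Rightarrow> 'c::ring_1) \<Rightarrow> _" for i
  by standard (auto simp: xop_def fun_eq_iff)

interpretation dop: additive "dop i :: ((nat \<Rightarrow> nat) \<Rightarrow> 'c::ring_1) \<Rightarrow> _" for i
  by standard (simp add: dop_def fun_eq_iff distrib_left)

interpretation lop: additive "lop c :: ((nat \<Rightarrow> nat) \<Rightarrow> 'c::ring_1) \<Rightarrow> _" for c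
  by standard (simp add: lop_def fun_eq_iff distrib_left)

interpretation rop: additive "rop c :: ((nat \<Rightarrow> nat) \<Rightarrow> 'c::ring_1) \<Rightarrow> _" for c
  by standard (simp add: rop_def fun_eq_iff distrib_right)

lemma lop_lop: "lop c (lop d f) = lop (c * d) f"
  by (simp add: lop_def mult.assoc)

lemma lop_add_left: "lop (c + d) f = lop c f + lop d f"
  by (simp add: lop_def fun_eq_iff distrib_right)

lemma lop_zero_left [simp]: "lop 0 f = 0"
  by (simp add: lop_def fun_eq_iff)

lemma lop_one [simp]: "lop 1 f = f"
  by (simp add: lop_def)

lemma lop_sum_left: "lop (sum c A) f = (\<Sum>i\<in>A. lop (c i) f)"
  by (induction A rule: infinite_finite_induct) (simp_all add: lop_add_left)

lemma lop_xop: "lop c (xop i f) = xop i (lop c f)"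
  by (auto simp: lop_def xop_def)

lemma of_nat_left_commute: "of_nat k * (c * d) = c * (of_nat k * (d::'c::ring_1))"
  by (metis mult.assoc mult_of_nat_commute)

lemma rop_lop: "lop c (rop d f) = rop d (lop c f)"
  by (simp add: lop_def rop_def mult.assoc)

lemma dop_lop: "dop i (lop c f) = lop c (dop i f)"
  by (simp add: lop_def dop_def of_nat_left_commute del: of_nat_Suc)

lemma dop_dop: "dop i (dop j f) = dop j (dop i f)"
proof (cases "i = j")
  case False
  then show ?thesis
    by (simp add: dop_def fun_eq_iff fun_upd_twist[OF False] mult.assoc[symmetric] mult.commute
        of_nat_mult[symmetric] del: of_nat_Suc of_nat_mult)
qed auto

text \<open>The canonical commutation relation. For equal indices the left side multiplies the
  coefficient at alpha by alpha i + 1 and \<open>xop i (dop i f)\<close> multiplies it by alpha i,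
  also when alpha i is 0.\<close>

lemma dop_xop: "dop j (xop i f) = xop i (dop j f) + (if i = j then f else 0)"
proof (cases "i = j")
  case True
  have "of_nat (Suc (\<alpha> i)) * f \<alpha> = xop i (dop i f) \<alpha> + f \<alpha>" for \<alpha>
    by (cases "\<alpha> i") (auto simp: xop_def dop_def distrib_right fun_upd_idem)
  then show ?thesis
    using True by (simp add: fun_eq_iff dop_def[of _ "xop _ _"]) (simp add: xop_def)
next
  case False
  then show ?thesis
    by (auto simp: xop_def dop_def fun_eq_iff fun_upd_twist)
qed

lemma dop_const: "dop i (const c) = 0"
  by (auto simp: dop_def const_def fun_eq_iff)

lemma lop_const: "lop d (const c) = const (d * c)"
  by (auto simp: lop_def const_def)

lemma rop_const: "rop d (const c) = const (c * d)"
  by (auto simp: rop_def const_def)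

lemma const_add: "const (c + d) = const c + const d"
  for c d :: "'c::ring_1"
  by (auto simp: const_def fun_eq_iff)

lemma const_zero: "const 0 = 0"
  by (auto simp: const_def fun_eq_iff)

lemma const_Vsp: "const c \<in> Vsp n"
  by (auto simp: Vsp_def const_def)

lemma Vsp_zero: "0 \<in> Vsp n"
  by (simp add: Vsp_def)

section \<open>Stability of the polynomial space and closure properties of the operator
  algebra\<close>

lemma Vsp_I:
  assumes "finite A" "{\<alpha>. f \<alpha> \<noteq> 0} \<subseteq> A" "\<And>\<alpha> i. f \<alpha> \<noteq> 0 \<Longrightarrow> i \<ge> n \<Longrightarrow> \<alpha> i = 0"
  shows "f \<in> Vsp n"
  using finite_subset[OF assms(2,1)] assms(3) by (simp add: Vsp_def)

lemma Vsp_finite: "f \<in> Vsp n \<Longrightarrow> finite {\<alpha>. f \<alpha> \<noteq> 0}"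
  and Vsp_vanish: "f \<in> Vsp n \<Longrightarrow> f \<alpha> \<noteq> 0 \<Longrightarrow> i \<ge> n \<Longrightarrow> \<alpha> i = 0"
  by (simp_all add: Vsp_def)

lemma Vsp_add:
  fixes f g :: "(nat \<Rightarrow> nat) \<Rightarrow> 'c::ring_1"
  assumes "f \<in> Vsp n" "g \<in> Vsp n"
  shows "f + g \<in> Vsp n"
proof (rule Vsp_I)
  show "finite ({\<alpha>. f \<alpha> \<noteq> 0} \<union> {\<alpha>. g \<alpha> \<noteq> 0})"
    using assms by (simp add: Vsp_finite)
  show "\<alpha> i = 0" if "(f + g) \<alpha> \<noteq> 0" "i \<ge> n" for \<alpha> i
    using that Vsp_vanish[OF assms(1), of \<alpha> i] Vsp_vanish[OF assms(2), of \<alpha> i] by fastforce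
qed auto

lemma Vsp_xop:
  assumes "f \<in> Vsp n" "i < n"
  shows "xop i f \<in> Vsp n"
proof (rule Vsp_I)
  show "finite ((\<lambda>\<alpha>. \<alpha>(i := Suc (\<alpha> i))) ` {\<alpha>. f \<alpha> \<noteq> 0})"
    using assms by (simp add: Vsp_finite)
  have *: "\<alpha> i > 0 \<and> f (\<alpha>(i := \<alpha> i - 1)) \<noteq> 0" if "xop i f \<alpha> \<noteq> 0" for \<alpha>
    using that by (auto simp: xop_def split: if_splits)
  show "{\<alpha>. xop i f \<alpha> \<noteq> 0} \<subseteq> (\<lambda>\<alpha>. \<alpha>(i := Suc (\<alpha> i))) ` {\<alpha>. f \<alpha> \<noteq> 0}"
  proof
    fix \<alpha> assume "\<alpha> \<in> {\<alpha>. xop i f \<alpha> \<noteq> 0}"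
    with * have "\<alpha> i > 0 \<and> f (\<alpha>(i := \<alpha> i - 1)) \<noteq> 0"
      by simp
    then show "\<alpha> \<in> (\<lambda>\<alpha>. \<alpha>(i := Suc (\<alpha> i))) ` {\<alpha>. f \<alpha> \<noteq> 0}"
      by (intro image_eqI[of _ _ "\<alpha>(i := \<alpha> i - 1)"]) auto
  qed
  show "\<alpha> j = 0" if "xop i f \<alpha> \<noteq> 0" "j \<ge> n" for \<alpha> j
    using Vsp_vanish[OF assms(1), of "\<alpha>(i := \<alpha> i - 1)" j] *[OF that(1)] that(2) assms(2) by simp
qed

lemma Vsp_dop:
  assumes "f \<in> Vsp n" "i < n"
  shows "dop i f \<in> Vsp n"
proof (rule Vsp_I)
  show "finite ((\<lambda>\<alpha>. \<alpha>(i := \<alpha> i - 1)) ` {\<alpha>. f \<alpha> \<noteq> 0})"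
    using assms by (simp add: Vsp_finite)
  have *: "f (\<alpha>(i := Suc (\<alpha> i))) \<noteq> 0" if "dop i f \<alpha> \<noteq> 0" for \<alpha>
    using that by (auto simp: dop_def)
  show "{\<alpha>. dop i f \<alpha> \<noteq> 0} \<subseteq> (\<lambda>\<alpha>. \<alpha>(i := \<alpha> i - 1)) ` {\<alpha>. f \<alpha> \<noteq> 0}"
  proof
    fix \<alpha> assume "\<alpha> \<in> {\<alpha>. dop i f \<alpha> \<noteq> 0}"
    then have "f (\<alpha>(i := Suc (\<alpha> i))) \<noteq> 0"
      using *[of \<alpha>] by blast
    then show "\<alpha> \<in> (\<lambda>\<alpha>. \<alpha>(i := \<alpha> i - 1)) ` {\<alpha>. f \<alpha> \<noteq> 0}"
      by (intro image_eqI[of _ _ "\<alpha>(i := Suc (\<alpha> i))"]) auto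
  qed
  show "\<alpha> j = 0" if "dop i f \<alpha> \<noteq> 0" "j \<ge> n" for \<alpha> j
    using Vsp_vanish[OF assms(1), of "\<alpha>(i := Suc (\<alpha> i))" j] *[of \<alpha>] that assms(2) by simp
qed

lemma Vsp_lop:
  assumes "f \<in> Vsp n"
  shows "lop c f \<in> Vsp n"
proof (rule Vsp_I[OF Vsp_finite[OF assms]])
  have *: "f \<alpha> \<noteq> 0" if "lop c f \<alpha> \<noteq> 0" for \<alpha>
    using that by (auto simp: lop_def)
  then show "{\<alpha>. lop c f \<alpha> \<noteq> 0} \<subseteq> {\<alpha>. f \<alpha> \<noteq> 0}"
    by blast
  show "\<alpha> i = 0" if "lop c f \<alpha> \<noteq> 0" "i \<ge> n" for \<alpha> i
    by (rule Vsp_vanish[OF assms *[OF that(1)] that(2)])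
qed

lemma Vsp_rop:
  assumes "f \<in> Vsp n"
  shows "rop c f \<in> Vsp n"
proof (rule Vsp_I[OF Vsp_finite[OF assms]])
  have *: "f \<alpha> \<noteq> 0" if "rop c f \<alpha> \<noteq> 0" for \<alpha>
    using that by (auto simp: rop_def)
  then show "{\<alpha>. rop c f \<alpha> \<noteq> 0} \<subseteq> {\<alpha>. f \<alpha> \<noteq> 0}"
    by blast
  show "\<alpha> i = 0" if "rop c f \<alpha> \<noteq> 0" "i \<ge> n" for \<alpha> i
    by (rule Vsp_vanish[OF assms *[OF that(1)] that(2)])
qed

lemma WC_Vsp: "a \<in> WC n sc gam \<Longrightarrow> f \<in> Vsp n \<Longrightarrow> a f \<in> Vsp n"
proof (induction arbitrary: f rule: WC.induct)
  case (WC_add a b)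
  then show ?case
    using Vsp_add[of "a f" n "b f"] by (simp add: plus_fun_def)
qed (simp_all add: Vsp_xop Vsp_dop Vsp_lop)

lemma WC_plus: "a \<in> WC n sc gam \<Longrightarrow> b \<in> WC n sc gam \<Longrightarrow> a + b \<in> WC n sc gam"
  using WC_add[of a n sc gam b] by (simp add: plus_fun_def)

lemma WC_additive: "a \<in> WC n sc gam \<Longrightarrow> additive a"
proof (induction rule: WC.induct)
  case (WC_add a b)
  then have *: "a (x + y) = a x + a y" "b (x + y) = b x + b y" for x y
    by (simp_all add: additive.add)
  show ?case
    by (rule additive.intro) (simp only: *, simp add: fun_eq_iff)
qed (simp_all add: additive_def xop.add dop.add lop.add)

text \<open>Left and right multiplications commute and the integer factors in \<open>dop\<close> are
  central. This is what makes the two actions on \<open>Vplus\<close> fit together into one of the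
  tensor product.\<close>

lemma WC_rop: "a \<in> WC n sc gam \<Longrightarrow> a (rop c f) = rop c (a f)"
proof (induction arbitrary: f rule: WC.induct)
  case (WC_d i)
  show ?case by (simp add: dop_def rop_def mult.assoc)
next
  case (WC_x i)
  show ?case by (auto simp: xop_def rop_def)
next
  case (WC_add a b)
  then show ?case by (simp add: rop_def distrib_right)
qed (simp_all add: rop_lop)

section \<open>The Clifford algebra and the operators built from it\<close>

locale dirac =
  fixes n :: nat and eta etainv :: "nat \<Rightarrow> nat \<Rightarrow> complex"
    and sc :: "complex \<Rightarrow> 'c::ring_1" and gam :: "nat \<Rightarrow> 'c"
  assumes eta_sym: "i < n \<Longrightarrow> j < n \<Longrightarrow> eta i j = eta j i"
    and eta_inv: "i < n \<Longrightarrow> j < n \<Longrightarrow> (\<Sum>k<n. eta i k * etainv k j) = (if i = j then 1 else 0)"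
    and Cl: "is_Cl n eta sc gam"
begin

lemma sc_add: "sc (a + b) = sc a + sc b"
  and sc_mult: "sc (a * b) = sc a * sc b"
  and sc_1 [simp]: "sc 1 = 1"
  and sc_central: "sc a * c = c * sc a"
  and gam_anticomm: "i < n \<Longrightarrow> j < n \<Longrightarrow> gam i * gam j + gam j * gam i = sc (2 * eta i j)"
  and Cl_expand: "\<exists>k. c = (\<Sum>S\<in>Pow {..<n}. sc (k S) * clmono gam S)"
proof -
  note * = Cl[unfolded is_Cl_def]
  show "sc (a + b) = sc a + sc b" using conjunct1[OF *] by simp
  note * = conjunct2[OF *]
  show "sc (a * b) = sc a * sc b" using conjunct1[OF *] by simp
  note * = conjunct2[OF *]
  show "sc 1 = 1" using conjunct1[OF *] by simp
  note * = conjunct2[OF *]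
  show "sc a * c = c * sc a" by (rule conjunct1[OF *, rule_format])
  note * = conjunct2[OF *]
  show "i < n \<Longrightarrow> j < n \<Longrightarrow> gam i * gam j + gam j * gam i = sc (2 * eta i j)"
    by (rule conjunct1[OF *, rule_format])
  note * = conjunct2[OF *]
  show "\<exists>k. c = (\<Sum>S\<in>Pow {..<n}. sc (k S) * clmono gam S)"
    using ex1_implies_ex[OF spec[OF *]] by blast
qed

sublocale sc: additive sc
  by standard (rule sc_add)

lemma sc_0 [simp]: "sc 0 = 0"
  by (rule sc.zero)

lemma sc_of_nat: "sc (of_nat k) = of_nat k"
  by (induction k) (simp_all add: sc_add)

lemma sc_numeral [simp]: "sc (numeral k) = numeral k"
  using sc_of_nat[of "numeral k"] by simp

text \<open>The coefficient ring is only a \<open>ring_1\<close>, so every division by 2 or by a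
  positive integer goes through the embedded complex scalars.\<close>

lemma sc_cancel: "z \<noteq> 0 \<Longrightarrow> sc (inverse z) * (sc z * c) = c"
  unfolding mult.assoc[symmetric] sc_mult[symmetric] by simp

lemma sc_mult_eq_0_iff: "sc z * c = 0 \<longleftrightarrow> z = 0 \<or> c = 0"
proof (cases "z = 0")
  case False
  then show ?thesis
    using sc_cancel[of z c] by auto
qed simp

lemma of_nat_mult_eq_0_iff: "of_nat k * (c::'c) = 0 \<longleftrightarrow> k = 0 \<or> c = 0"
  using sc_mult_eq_0_iff[of "of_nat k" c] by (simp add: sc_of_nat)

lemma lop_sc_lop: "lop c (lop (sc z) f) = lop (sc z) (lop c f)"
  unfolding lop_lop by (subst sc_central) (rule refl)

text \<open>Every element is a combination of ordered monomials, and each monomial is reached from 1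
  by left multiplications with generators. The case of 0 is 1 scaled by the scalar 0.\<close>

lemma Cl_induct [case_names one gen scale plus]:
  assumes "P 1" "\<And>i a. i < n \<Longrightarrow> P a \<Longrightarrow> P (gam i * a)"
    "\<And>z a. P a \<Longrightarrow> P (sc z * a)" "\<And>a b. P a \<Longrightarrow> P b \<Longrightarrow> P (a + b)"
  shows "P c"
proof -
  have P0: "P 0"
    using assms(3)[of 1 0] assms(1) by simp
  have fold: "P (foldr (\<lambda>i acc. gam i * acc) xs 1)" if "set xs \<subseteq> {..<n}" for xs
    using that by (induction xs) (simp_all add: assms(1,2))
  have mono: "P (clmono gam S)" if "S \<subseteq> {..<n}" for S
    unfolding clmono_def using that finite_subset[OF that] by (simp add: fold)
  have "P (\<Sum>S\<in>A. sc (k S) * clmono gam S)" if "finite A" "A \<subseteq> Pow {..<n}" for k A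
    using that by (induction A) (simp_all add: P0 assms(3,4) mono)
  moreover obtain k where "c = (\<Sum>S\<in>Pow {..<n}. sc (k S) * clmono gam S)"
    using Cl_expand[of c] by blast
  ultimately show ?thesis
    by simp
qed

lemma WC_zero: "0 \<in> WC n sc gam"
  using WC_scal[OF WC_id, where z = 0 and n = n and sc = sc and gam = gam]
  by (simp add: comp_def zero_fun_def)

lemma WC_sum: "(\<And>i. i \<in> A \<Longrightarrow> F i \<in> WC n sc gam) \<Longrightarrow> sum F A \<in> WC n sc gam"
  by (induction A rule: infinite_finite_induct) (auto intro: WC_zero WC_plus)

lemma WC_sc: "lop (sc z) \<in> WC n sc gam"
  using WC_scal[OF WC_id] by simp

lemma WC_lop: "lop c \<in> WC n sc gam"
proof (induction c rule: Cl_induct)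
  case one
  show ?case using WC_sc[of 1] unfolding sc_1 .
next
  case (gen i a)
  then show ?case using WC_comp[OF WC_g, where b = "lop a"]
    by (simp add: comp_def lop_lop)
next
  case (scale z a)
  then show ?case using WC_scal[of "lop a" n sc gam z]
    by (simp add: comp_def lop_lop)
next
  case (plus a b)
  then show ?case using WC_plus[of "lop a" n sc gam "lop b"]
    by (simp add: plus_fun_def lop_add_left)
qed

lemma WC_minus:
  assumes "a \<in> WC n sc gam" "b \<in> WC n sc gam"
  shows "a - b \<in> WC n sc gam"
proof -
  have "a - b = a + (lop (- 1) \<circ> b)"
    by (simp add: fun_eq_iff lop_def)
  then show ?thesis
    using WC_plus[OF assms(1) WC_comp[OF WC_lop assms(2)]] by metis
qed

lemmas WC_intros = WC_id WC_x WC_d WC_lop WC_plus WC_minus WC_comp WC_sum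

lemma WC_lop_sc_commute: "a \<in> WC n sc gam \<Longrightarrow> a (lop (sc z) f) = lop (sc z) (a f)"
proof (induction arbitrary: f rule: WC.induct)
  case (WC_add a b)
  then show ?case by (simp add: fun_eq_iff lop_def distrib_left)
next
  case (WC_g i)
  show ?case by (rule lop_sc_lop)
next
  case (WC_scal a w)
  then show ?case by (simp add: lop_sc_lop[of _ z])
qed (simp_all add: lop_xop dop_lop)

text \<open>The generators with lowered index. They are dual to \<open>gam\<close> for the
  anticommutator, which is what lets \<open>Yop\<close> pair with \<open>Dirac\<close> for an
  arbitrary \<open>eta\<close>.\<close>

definition lgam :: "nat \<Rightarrow> 'c" where
  "lgam j = (\<Sum>k<n. sc (etainv k j) * gam k)"

definition Dirac :: "'c op" where
  "Dirac = (\<Sum>i<n. lop (gam i) \<circ> dop i)"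

definition Yop :: "'c op" where
  "Yop = (\<Sum>i<n. lop (lgam i) \<circ> xop i)"

definition dup :: "nat \<Rightarrow> 'c op" where
  "dup i = (\<Sum>j<n. lop (sc (eta i j)) \<circ> dop j)"

definition Euler :: "'c op" where
  "Euler = (\<Sum>i<n. xop i \<circ> dop i)"

abbreviation scal :: "complex \<Rightarrow> 'c op" where
  "scal z \<equiv> lop (sc z)"

abbreviation "\<W> \<equiv> WC n sc gam"
abbreviation "\<N> \<equiv> Nrm n eta sc gam"
abbreviation "\<I> \<equiv> Iid n eta sc gam"
abbreviation "X \<equiv> Xop n sc gam"
abbreviation "E \<equiv> Eop n eta sc"
abbreviation "Vp \<equiv> Vplus n sc gam"

lemma Dirac_WC: "Dirac \<in> \<W>" and Yop_WC: "Yop \<in> \<W>"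
  and dup_WC: "dup i \<in> \<W>" and Euler_WC: "Euler \<in> \<W>"
  unfolding Dirac_def Yop_def dup_def Euler_def by (auto intro!: WC_intros)

sublocale Dirac: additive Dirac by (rule WC_additive[OF Dirac_WC])
sublocale Yop: additive Yop by (rule WC_additive[OF Yop_WC])
sublocale dup: additive "dup i" for i by (rule WC_additive[OF dup_WC])
sublocale Euler: additive Euler by (rule WC_additive[OF Euler_WC])

lemma Dirac_apply: "Dirac f = (\<Sum>i<n. lop (gam i) (dop i f))"
  and Yop_apply: "Yop f = (\<Sum>i<n. lop (lgam i) (xop i f))"
  and dup_apply: "dup i f = (\<Sum>j<n. scal (eta i j) (dop j f))"
  and Euler_apply: "Euler f = (\<Sum>i<n. xop i (dop i f))"
  by (simp_all add: Dirac_def Yop_def dup_def Euler_def sum_fun_eval)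

lemma Euler_degree: "Euler f \<alpha> = of_nat (\<Sum>i<n. \<alpha> i) * f \<alpha>"
proof -
  have "xop i (dop i f) \<alpha> = of_nat (\<alpha> i) * f \<alpha>" for i
    by (auto simp: xop_def dop_def simp del: of_nat_Suc)
  then show ?thesis
    by (simp add: Euler_apply sum_fun_eval sum_distrib_right)
qed

lemma X_Dirac: "X f = scal (\<i> / complex_of_real (sqrt 2)) (Dirac f)"
  by (simp add: Xop_def Dirac_apply fun_eq_iff sum_fun_eval lop_def sum_distrib_left)

lemma X_WC: "X \<in> \<W>"
proof -
  have "X = scal (\<i> / complex_of_real (sqrt 2)) \<circ> Dirac"
    by (simp add: fun_eq_iff X_Dirac)
  then show ?thesis
    by (simp add: WC_comp WC_lop Dirac_WC)
qed

sublocale X: additive X by (rule WC_additive[OF X_WC])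

lemma X_eq_0_iff: "X f = 0 \<longleftrightarrow> Dirac f = 0"
proof
  assume "X f = 0"
  then have "sc (\<i> / complex_of_real (sqrt 2)) * Dirac f \<alpha> = 0" for \<alpha>
    unfolding X_Dirac by (simp add: lop_def fun_eq_iff)
  then show "Dirac f = 0"
    by (simp add: sc_mult_eq_0_iff fun_eq_iff)
qed (simp add: X_Dirac lop.zero)

lemma V_plus_iff: "f \<in> Vp \<longleftrightarrow> f \<in> Vsp n \<and> Dirac f = 0"
  using X_eq_0_iff by (simp add: Vplus_def zero_fun_def)

text \<open>Partial derivatives commute, so the double sum may also be written with the two
  generators exchanged. Adding both forms produces the anticommutator, hence twice the claim, and 2
  is then cancelled.\<close>

lemma Dirac_squared: "Dirac (Dirac f) = (\<Sum>i<n. \<Sum>j<n. scal (eta i j) (dop i (dop j f)))"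
proof -
  have D2: "Dirac (Dirac f) = (\<Sum>i<n. \<Sum>j<n. lop (gam i * gam j) (dop i (dop j f)))" (is "_ = ?L")
    by (simp add: Dirac_apply dop.sum lop.sum dop_lop lop_lop)
  also have "?L = (\<Sum>j<n. \<Sum>i<n. lop (gam i * gam j) (dop i (dop j f)))"
    by (rule sum.swap)
  finally have D2': "Dirac (Dirac f) = (\<Sum>i<n. \<Sum>j<n. lop (gam j * gam i) (dop i (dop j f)))"
    by (simp add: dop_dop)
  have "Dirac (Dirac f) + Dirac (Dirac f)
      = (\<Sum>i<n. \<Sum>j<n. lop (gam i * gam j + gam j * gam i) (dop i (dop j f)))"
    by (subst D2', subst D2) (simp add: sum.distrib[symmetric] lop_add_left add.commute)
  also have "\<dots> = (\<Sum>i<n. \<Sum>j<n. scal 2 (scal (eta i j) (dop i (dop j f))))"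
    by (intro sum.cong) (simp_all add: gam_anticomm sc_mult lop_lop)
  also have "\<dots> = scal 2 (\<Sum>i<n. \<Sum>j<n. scal (eta i j) (dop i (dop j f)))"
    by (simp add: lop.sum)
  finally have eq: "scal 2 (Dirac (Dirac f)) = scal 2 (\<Sum>i<n. \<Sum>j<n. scal (eta i j) (dop i (dop j f)))"
    using lop_add_left[of 1 1 "Dirac (Dirac f)"] by simp
  show ?thesis
    using arg_cong[OF eq, of "scal (inverse 2)"] by (simp add: lop_lop sc_mult[symmetric] del: sc_numeral)
qed

lemma E_eq: "E f = X (X f)"
proof -
  have "(\<i> / complex_of_real (sqrt 2)) * (\<i> / complex_of_real (sqrt 2)) = - 1 / 2"
    by (simp add: of_real_mult[symmetric] del: of_real_mult)
  then have "X (X f) = scal (- 1 / 2) (Dirac (Dirac f))"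
    by (simp only: X_Dirac WC_lop_sc_commute[OF Dirac_WC] lop_lop sc_mult[symmetric])
  also have "\<dots> = E f"
    by (simp add: Dirac_squared Eop_def lop_def fun_eq_iff sum_fun_eval)
  finally show ?thesis by simp
qed

section \<open>The left ideal, its normalizer and the action on solutions\<close>

lemma Iid_intro:
  assumes "a \<in> \<W>" "b \<in> \<W>" "c \<in> \<W>" "\<And>f. f \<in> Vsp n \<Longrightarrow> a f = b (X f) + c (E f)"
  shows "a \<in> \<I>"
  unfolding Iid_def using assms by (auto simp: plus_fun_def)

lemma Iid_elim:
  assumes "a \<in> \<I>"
  obtains b c where "b \<in> \<W>" "c \<in> \<W>" "\<And>f. f \<in> Vsp n \<Longrightarrow> a f = b (X f) + c (E f)"
  using assms unfolding Iid_def plus_fun_def by blast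

lemma Nrm_intro:
  assumes "a \<in> \<W>" "b \<in> \<W>" "\<And>f. Dirac (a f) = b (Dirac f)"
  shows "a \<in> \<N>"
proof -
  have Xa: "X (a f) = b (X f)" for f
    by (simp add: X_Dirac assms(3) WC_lop_sc_commute[OF assms(2)])
  have "i \<circ> a \<in> \<I>" if "i \<in> \<I>" for i
  proof -
    from \<open>i \<in> \<I>\<close> obtain b' c' where i: "b' \<in> \<W>" "c' \<in> \<W>"
      "\<And>f. f \<in> Vsp n \<Longrightarrow> i f = b' (X f) + c' (E f)"
      by (rule Iid_elim) blast
    have "i \<in> \<W>"
      using \<open>i \<in> \<I>\<close> by (simp add: Iid_def)
    show ?thesis
    proof (rule Iid_intro)
      \<comment> \<open>As \<open>E\<close> is \<open>X\<close> applied twice,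
        \<open>c' (E (a f))\<close> equals \<open>c' (X (b (X f)))\<close>. It is absorbed into the
        coefficient of \<open>X\<close>, which leaves 0 as coefficient of \<open>E\<close>.\<close>
      show "(i \<circ> a) f = ((b' \<circ> b) + (c' \<circ> (X \<circ> b))) (X f) + 0 (E f)" if "f \<in> Vsp n" for f
        using i(3)[OF WC_Vsp[OF assms(1) that]] by (simp add: E_eq Xa)
    qed (intro WC_zero WC_plus WC_comp i assms X_WC \<open>i \<in> \<W>\<close>)+
  qed
  then show ?thesis
    using assms(1) by (simp add: Nrm_def)
qed

lemma Nrm_WC: "a \<in> \<N> \<Longrightarrow> a \<in> \<W>"
  by (simp add: Nrm_def)

lemma I_kills:
  assumes "a \<in> \<I>" "f \<in> Vp"
  shows "a f = 0"
proof -
  from assms(1) obtain b c where bc: "b \<in> \<W>" "c \<in> \<W>"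
    "\<And>f. f \<in> Vsp n \<Longrightarrow> a f = b (X f) + c (E f)"
    by (rule Iid_elim) blast
  have "X f = 0" "f \<in> Vsp n"
    using assms(2) by (simp_all add: V_plus_iff X_eq_0_iff)
  moreover have "b 0 = 0" "c 0 = 0"
    using additive.zero[OF WC_additive] bc by blast+
  ultimately show ?thesis
    by (simp add: bc(3) E_eq X.zero)
qed

lemma X_in_I: "X \<in> \<I>"
  by (rule Iid_intro[OF X_WC WC_id WC_zero]) simp

text \<open>The normalizer condition, tested on \<open>X\<close> itself, puts
  \<open>X \<circ> a\<close> into the ideal, and the ideal annihilates solutions.\<close>

lemma Nrm_V_plus:
  assumes "a \<in> \<N>" "f \<in> Vp"
  shows "a f \<in> Vp"
proof -
  have "X \<circ> a \<in> \<I>"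
    using assms(1) X_in_I by (simp add: Nrm_def)
  then have "X (a f) = 0"
    using I_kills[OF _ assms(2), of "X \<circ> a"] by simp
  moreover have "a f \<in> Vsp n"
    using WC_Vsp[OF Nrm_WC[OF assms(1)]] assms(2) by (simp add: V_plus_iff)
  ultimately show ?thesis
    by (simp add: V_plus_iff X_eq_0_iff)
qed

lemma rop_V_plus: "f \<in> Vp \<Longrightarrow> rop c f \<in> Vp"
  by (simp add: V_plus_iff WC_rop[OF Dirac_WC] Vsp_rop rop.zero)

section \<open>Ladder operators on monogenic polynomials\<close>

lemma sc_left_commute: "c * (sc z * d) = sc z * (c * d)"
  by (metis sc_central mult.assoc)

lemma Dirac_dop: "Dirac (dop i f) = dop i (Dirac f)"
  unfolding Dirac_apply dop.sum dop_lop by (simp add: dop_dop[of i])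

lemma Dirac_dup: "Dirac (dup i f) = dup i (Dirac f)"
  by (simp add: dup_apply Dirac.sum WC_lop_sc_commute[OF Dirac_WC] Dirac_dop)

text \<open>The term \<open>dup i f + dup i f\<close> is the obstruction to
  \<open>lop (gam i)\<close> preserving solutions; \<open>gam_hat\<close> is built to cancel
  it.\<close>

lemma Dirac_gam:
  assumes "i < n"
  shows "Dirac (lop (gam i) f) = dup i f + dup i f - lop (gam i) (Dirac f)"
proof -
  have "Dirac (lop (gam i) f) + lop (gam i) (Dirac f)
      = (\<Sum>j<n. lop (gam i * gam j + gam j * gam i) (dop j f))"
    unfolding Dirac_apply lop.sum dop_lop lop_lop lop_add_left sum.distrib by (rule add.commute)
  also have "\<dots> = (\<Sum>j<n. scal (eta i j) (dop j f) + scal (eta i j) (dop j f))"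
    using assms by (intro sum.cong refl) (simp only: gam_anticomm lessThan_iff mult_2 sc_add lop_add_left)
  finally show ?thesis
    unfolding dup_apply sum.distrib eq_diff_eq .
qed

lemma xop_xop: "xop i (xop j f) = xop j (xop i f)"
proof (cases "i = j")
  case False
  then show ?thesis
    by (auto simp: xop_def fun_eq_iff fun_upd_twist)
qed auto

lemma Dirac_xop:
  assumes "i < n"
  shows "Dirac (xop i f) = xop i (Dirac f) + lop (gam i) f"
proof -
  have "lop (gam j) (dop j (xop i f)) = xop i (lop (gam j) (dop j f)) + (if j = i then lop (gam i) f else 0)" for j
    by (auto simp: dop_xop lop.add lop.zero lop_xop)
  then show ?thesis
    using assms by (simp add: Dirac_apply xop.sum sum.distrib)
qed

lemma dop_Euler:
  assumes "i < n"
  shows "dop i (Euler f) = Euler (dop i f) + dop i f"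
proof -
  have "dop i (xop j (dop j f)) = xop j (dop j (dop i f)) + (if j = i then dop i f else 0)" for j
    unfolding dop_xop dop_dop[of i j] by simp
  then show ?thesis
    using assms by (simp add: Euler_apply dop.sum sum.distrib)
qed

lemma Euler_xop:
  assumes "i < n"
  shows "Euler (xop i f) = xop i (Euler f) + xop i f"
proof -
  have "xop j (dop j (xop i f)) = xop i (xop j (dop j f)) + (if j = i then xop i f else 0)" for j
    unfolding dop_xop xop.add by (subst xop_xop) (simp add: xop.zero)
  then show ?thesis
    using assms by (simp add: Euler_apply xop.sum sum.distrib)
qed

lemma Euler_lop: "Euler (lop c f) = lop c (Euler f)"
  by (simp add: Euler_apply lop.sum dop_lop lop_xop)

lemma dup_Euler: "dup i (Euler f) = Euler (dup i f) + dup i f"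
  by (simp add: dup_apply dop_Euler lop.add sum.distrib Euler.sum Euler_lop)

lemma Dirac_Euler: "Dirac (Euler f) = Euler (Dirac f) + Dirac f"
  by (simp add: Dirac_apply dop_Euler lop.add sum.distrib Euler.sum Euler_lop)

lemma Euler_Yop: "Euler (Yop f) = Yop (Euler f) + Yop f"
  by (simp add: Yop_apply Euler.sum Euler_lop Euler_xop lop.add sum.distrib)

text \<open>The locale states only that \<open>etainv\<close> is a right inverse. Entry (j,i) of the
  transpose of \<open>etainv\<close> times \<open>eta\<close> times \<open>etainv\<close> is
  evaluated in two ways, using the symmetry of \<open>eta\<close> in between.\<close>

lemma etainv_sym:
  assumes "i < n" "j < n"
  shows "etainv i j = etainv j i"
proof -
  have "etainv j i = (\<Sum>k<n. (\<Sum>l<n. eta k l * etainv l j) * etainv k i)"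
    using assms by (simp add: eta_inv if_distrib[of "\<lambda>x. x * _"] cong: if_cong)
  also have "\<dots> = (\<Sum>k<n. \<Sum>l<n. eta k l * etainv l j * etainv k i)"
    by (simp add: sum_distrib_right)
  also have "\<dots> = (\<Sum>l<n. \<Sum>k<n. eta k l * etainv l j * etainv k i)"
    by (rule sum.swap)
  also have "\<dots> = (\<Sum>l<n. (\<Sum>k<n. eta l k * etainv k i) * etainv l j)"
    unfolding sum_distrib_right
  proof (intro sum.cong refl)
    fix l k assume "l \<in> {..<n}" "k \<in> {..<n}"
    then have "eta k l = eta l k"
      by (simp add: eta_sym)
    then show "eta k l * etainv l j * etainv k i = eta l k * etainv k i * etainv l j"
      by simp
  qed
  also have "\<dots> = etainv i j"
    using assms by (simp add: eta_inv if_distrib[of "\<lambda>x. x * _"] cong: if_cong)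
  finally show ?thesis ..
qed

lemma gam_lgam:
  assumes "i < n" "j < n"
  shows "gam i * lgam j + lgam j * gam i = (if i = j then 2 else 0)"
proof -
  have "gam i * lgam j + lgam j * gam i = (\<Sum>k<n. sc (etainv k j) * (gam i * gam k + gam k * gam i))"
    by (simp add: lgam_def sum_distrib_left sum_distrib_right sum.distrib[symmetric] distrib_left
        mult.assoc sc_left_commute[of "gam i"])
  also have "\<dots> = (\<Sum>k<n. sc (2 * (eta i k * etainv k j)))"
    using assms by (intro sum.cong) (simp_all add: gam_anticomm sc_mult[symmetric] mult_ac del: sc_numeral)
  also have "\<dots> = sc (2 * (\<Sum>k<n. eta i k * etainv k j))"
    by (simp add: sum_distrib_left sc.sum)
  finally show ?thesis
    using assms by (simp add: eta_inv sc_mult)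
qed

text \<open>Symmetry of \<open>etainv\<close> makes the contraction independent of the order of its
  two factors, so twice it is the sum of the n anticommutators, each equal to 2.\<close>

lemma sum_gam_lgam: "(\<Sum>i<n. gam i * lgam i) = of_nat n"
proof -
  have eq: "(\<Sum>i<n. lgam i * gam i) = (\<Sum>i<n. gam i * lgam i)"
  proof -
    have "(\<Sum>i<n. lgam i * gam i) = (\<Sum>i<n. \<Sum>k<n. sc (etainv k i) * (gam k * gam i))"
      by (simp add: lgam_def sum_distrib_right mult.assoc)
    also have "\<dots> = (\<Sum>k<n. \<Sum>i<n. sc (etainv k i) * (gam k * gam i))"
      by (rule sum.swap)
    also have "\<dots> = (\<Sum>k<n. \<Sum>i<n. gam k * (sc (etainv i k) * gam i))"
    proof (intro sum.cong refl)
      fix k i assume "k \<in> {..<n}" "i \<in> {..<n}"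
      then have "etainv k i = etainv i k"
        by (simp add: etainv_sym)
      then show "sc (etainv k i) * (gam k * gam i) = gam k * (sc (etainv i k) * gam i)"
        by (simp only: sc_left_commute[of "gam k"])
    qed
    finally show ?thesis
      by (simp add: lgam_def sum_distrib_left)
  qed
  have "(\<Sum>i<n. gam i * lgam i) + (\<Sum>i<n. lgam i * gam i) = (\<Sum>i<n. 2)"
    unfolding sum.distrib[symmetric] by (intro sum.cong refl) (simp add: gam_lgam)
  also have "\<dots> = sc 2 * of_nat n"
    by (simp add: mult_2 mult_2_right)
  finally have "sc 2 * (\<Sum>i<n. gam i * lgam i) = sc 2 * of_nat n"
    by (simp only: eq sc_numeral mult_2)
  from arg_cong[OF this, of "\<lambda>x. sc (inverse 2) * x"] show ?thesis
    by (simp only: sc_cancel[OF zero_neq_numeral[symmetric]])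
qed

text \<open>Where the derivative passes the variable, the anticommutators collapse to twice
  \<open>Euler\<close>; where it hits the variable, the contraction of \<open>gam\<close> with
  \<open>lgam\<close> leaves n. This is the osp(1|2) relation on which both families of ladder
  operators rest.\<close>

lemma Dirac_Yop: "Dirac (Yop f) = Euler f + Euler f + scal (of_nat n) f - Yop (Dirac f)"
proof -
  have 1: "Yop (Dirac f) = (\<Sum>i<n. \<Sum>j<n. lop (lgam j * gam i) (xop j (dop i f)))"
    unfolding Yop_apply Dirac_apply
    by (subst sum.swap) (simp add: xop.sum lop.sum lop_xop[symmetric] lop_lop)
  have 2: "lop (gam i) (dop i (lop (lgam j) (xop j f)))
      = lop (gam i * lgam j) (xop j (dop i f)) + (if j = i then lop (gam i * lgam i) f else 0)" for i j
    by (auto simp: dop_lop dop_xop lop.add lop.zero lop_lop)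
  have "Dirac (Yop f) = (\<Sum>i<n. \<Sum>j<n. lop (gam i * lgam j) (xop j (dop i f)))
      + (\<Sum>i<n. lop (gam i * lgam i) f)"
    by (simp add: Yop_apply Dirac_apply dop.sum lop.sum 2 sum.distrib)
  moreover have "(\<Sum>i<n. lop (gam i * lgam i) f) = scal (of_nat n) f"
    by (simp add: lop_sum_left[symmetric] sum_gam_lgam sc_of_nat)
  ultimately have D:  "Dirac (Yop f) + Yop (Dirac f)
      = (\<Sum>i<n. \<Sum>j<n. lop (gam i * lgam j + lgam j * gam i) (xop j (dop i f))) + scal (of_nat n) f"
    by (simp add: 1 lop_add_left sum.distrib)
  have "(\<Sum>i<n. \<Sum>j<n. lop (gam i * lgam j + lgam j * gam i) (xop j (dop i f)))
      = (\<Sum>i<n. \<Sum>j<n. if i = j then lop 2 (xop i (dop i f)) else 0)"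
    by (intro sum.cong refl) (simp add: gam_lgam)
  also have "\<dots> = Euler f + Euler f"
    using lop_add_left[of "1::'c" 1] by (simp add: Euler_apply sum.distrib)
  finally show ?thesis
    using D by (simp add: eq_diff_eq)
qed

section \<open>Explicit elements of the normalizer\<close>

lemmas scal_commute = WC_lop_sc_commute[OF Dirac_WC] WC_lop_sc_commute[OF Yop_WC]
  WC_lop_sc_commute[OF dup_WC] WC_lop_sc_commute[OF Euler_WC] lop_xop[of "sc _", symmetric]

lemmas op_linear = Dirac.add Dirac.diff Yop.add Yop.diff dup.add dup.diff Euler.add Euler.diff
  xop.add xop.diff lop.add lop.diff

text \<open>On a solution f, \<open>Dirac\<close> sends \<open>lop (gam i) f\<close> to 2
  \<open>dup i f\<close>, and sends \<open>Yop (dup i f)\<close> to 2 H + n applied to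
  \<open>dup i f\<close>, with H for \<open>Euler\<close>. Multiplying the first term by a degree
  factor matches the two without division; moving H past \<open>dup i\<close> adds 2, hence the
  factor 2 H + n - 2.\<close>

definition gam_hat :: "nat \<Rightarrow> 'c op" where
  "gam_hat i f = lop (gam i) (Euler f + Euler f + scal (of_nat n) f - f - f)
     - Yop (dup i f) - Yop (dup i f)"

text \<open>On a solution f, \<open>Dirac\<close> of the first term is \<open>gam i\<close> times (2
  H + n) f. The second term cancels this up to twice \<open>Yop (dup i f)\<close>, and the third
  removes that remainder, since the commutator of \<open>Dirac\<close> with the square of
  \<open>Yop\<close> is twice \<open>Yop\<close>.\<close>

definition x_hat :: "nat \<Rightarrow> 'c op" where
  "x_hat i f = xop i (Euler f + Euler f + scal (of_nat n) f) - Yop (lop (gam i) f) - Yop (Yop (dup i f))"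

lemma dop_Nrm: "i < n \<Longrightarrow> dop i \<in> \<N>"
  by (rule Nrm_intro[where b = "dop i"]) (auto intro: WC_d Dirac_dop)

lemma gam_hat_Nrm:
  assumes "i < n"
  shows "gam_hat i \<in> \<N>"
proof (rule Nrm_intro)
  \<comment> \<open>\<open>gam_hat i\<close> is odd, so moving \<open>Dirac\<close> through it
    reverses the signs; \<open>Dirac\<close> also lowers the degree by one, which turns 2 H + n - 2
    into 2 H + n.\<close>
  let ?b = "(Yop \<circ> dup i) + (Yop \<circ> dup i)
    - (lop (gam i) \<circ> (Euler + Euler + scal (of_nat n)))"
  show "?b \<in> \<W>"
    by (intro WC_minus WC_plus WC_comp Euler_WC Yop_WC dup_WC WC_lop)
  have eq: "gam_hat i = (lop (gam i) \<circ> (Euler + Euler + scal (of_nat n) - id - id))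
      - (Yop \<circ> dup i) - (Yop \<circ> dup i)"
    by (rule ext) (simp add: gam_hat_def)
  show "gam_hat i \<in> \<W>"
    unfolding eq by (intro WC_minus WC_plus WC_comp Euler_WC Yop_WC dup_WC WC_lop WC_id)
  show "Dirac (gam_hat i f) = ?b (Dirac f)" for f
    using assms
    by (simp add: gam_hat_def op_linear scal_commute Dirac_gam Dirac_Yop Dirac_Euler dup_Euler Dirac_dup
        lop_sc_lop[of "gam i"] algebra_simps)
qed

lemma x_hat_Nrm:
  assumes "i < n"
  shows "x_hat i \<in> \<N>"
proof (rule Nrm_intro)
  \<comment> \<open>\<open>x_hat i\<close> is even, so the signs stay and only the degree factor
    shifts by 2.\<close>
  let ?b = "(xop i \<circ> (Euler + Euler + scal (of_nat n) + id + id))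
    - (Yop \<circ> lop (gam i)) - (Yop \<circ> (Yop \<circ> dup i))"
  show "?b \<in> \<W>"
    by (intro WC_minus WC_plus WC_comp Euler_WC Yop_WC dup_WC WC_lop WC_id WC_x assms)
  have eq: "x_hat i = (xop i \<circ> (Euler + Euler + scal (of_nat n)))
    - (Yop \<circ> lop (gam i)) - (Yop \<circ> (Yop \<circ> dup i))"
    by (rule ext) (simp add: x_hat_def)
  show "x_hat i \<in> \<W>"
    unfolding eq by (intro WC_minus WC_plus WC_comp Euler_WC Yop_WC dup_WC WC_lop WC_id WC_x assms)
  show "Dirac (x_hat i f) = ?b (Dirac f)" for f
    using assms
    by (simp add: x_hat_def op_linear scal_commute Dirac_gam Dirac_Yop Dirac_Euler dup_Euler Dirac_dup
        Dirac_xop Euler_Yop Euler_lop lop_sc_lop[of "gam i"] algebra_simps)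
qed

lemma gam_hat_const:
  assumes "i < n"
  shows "gam_hat i (const c) = const (sc (of_nat n - 2) * (gam i * c))"
proof -
  have "Euler (const c) = 0" "dup i (const c) = 0"
    by (simp_all add: Euler_apply dup_apply dop_const xop.zero lop.zero)
  then have "gam_hat i (const c) = scal (of_nat n) (const (gam i * c)) - const (gam i * c) - const (gam i * c)"
    by (simp add: gam_hat_def Yop.zero lop.diff lop_const sc_left_commute[of "gam i"])
  then show ?thesis
    unfolding lop_const by (auto simp: const_def fun_eq_iff sc.diff mult_2 left_diff_distrib)
qed

lemma Euler_dop_eigen:
  assumes "Euler f = scal (of_nat (Suc d)) f" "i < n"
  shows "Euler (dop i f) = scal (of_nat d) (dop i f)"
proof -
  have "Euler (dop i f) + dop i f = scal (of_nat d) (dop i f) + dop i f"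
    using dop_Euler[OF assms(2), of f]
    unfolding assms(1) of_nat_Suc sc_add lop_add_left sc_1 lop_one dop.add dop_lop
    by (simp only: add.commute)
  then show ?thesis by simp
qed

text \<open>The \<open>Yop\<close> terms contract to \<open>Dirac f\<close> and
  \<open>Dirac (Dirac f)\<close>, both zero, and \<open>Euler\<close> is all that remains. With the
  degree written as \<open>Suc d\<close>, the factor 2 d + n is 2 (d + 1) + n - 2, so no truncated
  subtraction occurs.\<close>

lemma sum_x_hat_dop:
  assumes "f \<in> Vp" and "Euler f = scal (of_nat (Suc d)) f"
  shows "(\<Sum>i<n. x_hat i (dop i f)) = scal (of_nat (Suc d * (2 * d + n))) f"
proof -
  have D: "Dirac f = 0"
    using assms by (simp add: V_plus_iff)
  have "x_hat i (dop i f) = scal (of_nat (2 * d + n)) (xop i (dop i f)) - Yop (lop (gam i) (dop i f))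
      - Yop (Yop (dup i (dop i f)))" if "i < n" for i
    unfolding x_hat_def Euler_dop_eigen[OF assms(2) that] mult_2 of_nat_add sc_add lop_add_left xop.add lop_xop by (rule refl)
  then have "(\<Sum>i<n. x_hat i (dop i f))
      = scal (of_nat (2 * d + n)) (Euler f) - Yop (Dirac f) - Yop (Yop (\<Sum>i<n. dup i (dop i f)))"
    unfolding Euler_apply Dirac_apply lop.sum Yop.sum sum_subtractf[symmetric]
    by (intro sum.cong) auto
  also have "(\<Sum>i<n. dup i (dop i f)) = Dirac (Dirac f)"
    unfolding dup_apply Dirac_squared by (intro sum.cong refl arg_cong[where f = "scal _"] dop_dop)
  finally have "(\<Sum>i<n. x_hat i (dop i f)) = scal (of_nat (2 * d + n)) (scal (of_nat (Suc d)) f)"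
    unfolding D Dirac.zero Yop.zero assms(2) diff_zero .
  then show ?thesis
    unfolding lop_lop sc_mult[symmetric] of_nat_mult[symmetric] by (simp only: mult.commute)
qed

section \<open>Subrepresentations and two-sided ideals\<close>

abbreviation "subrepr \<equiv> subrep n eta sc gam"
abbreviation "irred \<equiv> irred_subrep n eta sc gam"

definition coef_ideal :: "((nat \<Rightarrow> nat) \<Rightarrow> 'c) set \<Rightarrow> 'c set" where
  "coef_ideal W = {c. const c \<in> W}"

text \<open>Intersecting with it cuts a subrepresentation down to a prescribed smaller ideal of
  constants.\<close>

definition ideal_sub :: "'c set \<Rightarrow> ((nat \<Rightarrow> nat) \<Rightarrow> 'c) set" where
  "ideal_sub J = {f \<in> Vp. \<forall>\<alpha>. f \<alpha> \<in> J}"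

lemma subrep_iff: "subrepr W \<longleftrightarrow> W \<subseteq> Vp \<and> 0 \<in> W \<and> (\<forall>f\<in>W. \<forall>g\<in>W. f + g \<in> W) \<and>
    (\<forall>z. \<forall>f\<in>W. scal z f \<in> W) \<and> (\<forall>a\<in>\<N>. \<forall>f\<in>W. a f \<in> W) \<and> (\<forall>c. \<forall>f\<in>W. rop c f \<in> W)"
  unfolding subrep_def zero_fun_def plus_fun_def ..

lemma subrepD:
  assumes "subrepr W"
  shows "W \<subseteq> Vp" "0 \<in> W" "f \<in> W \<Longrightarrow> g \<in> W \<Longrightarrow> f + g \<in> W" "f \<in> W \<Longrightarrow> scal z f \<in> W"
    "a \<in> \<N> \<Longrightarrow> f \<in> W \<Longrightarrow> a f \<in> W" "f \<in> W \<Longrightarrow> rop c f \<in> W"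
proof -
  note * = assms[unfolded subrep_iff]
  show "W \<subseteq> Vp" by (rule conjunct1[OF *])
  note * = conjunct2[OF *]
  show "0 \<in> W" by (rule conjunct1[OF *])
  note * = conjunct2[OF *]
  show "f \<in> W \<Longrightarrow> g \<in> W \<Longrightarrow> f + g \<in> W" by (rule conjunct1[OF *, rule_format])
  note * = conjunct2[OF *]
  show "f \<in> W \<Longrightarrow> scal z f \<in> W" by (rule conjunct1[OF *, rule_format])
  note * = conjunct2[OF *]
  show "a \<in> \<N> \<Longrightarrow> f \<in> W \<Longrightarrow> a f \<in> W" by (rule conjunct1[OF *, rule_format])
  note * = conjunct2[OF *]
  show "f \<in> W \<Longrightarrow> rop c f \<in> W" by (rule *[rule_format])
qed

lemma subrepI:
  assumes "W \<subseteq> Vp" "0 \<in> W" "\<And>f g. f \<in> W \<Longrightarrow> g \<in> W \<Longrightarrow> f + g \<in> W" "\<And>z f. f \<in> W \<Longrightarrow> scal z f \<in> W"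
    "\<And>a f. a \<in> \<N> \<Longrightarrow> f \<in> W \<Longrightarrow> a f \<in> W" "\<And>c f. f \<in> W \<Longrightarrow> rop c f \<in> W"
  shows "subrepr W"
  unfolding subrep_iff
  by (rule conjI, rule assms(1), rule conjI, rule assms(2),
      rule conjI, rule ballI, rule ballI, erule assms(3), assumption,
      rule conjI, rule allI, rule ballI, erule assms(4),
      rule conjI, rule ballI, rule ballI, erule assms(5), assumption,
      rule allI, rule ballI, erule assms(6))

lemma subrep_sum:
  assumes "subrepr W" "\<And>i. i \<in> A \<Longrightarrow> F i \<in> W"
  shows "sum F A \<in> W"
  using assms(2) by (induction A rule: infinite_finite_induct) (simp_all add: subrepD(2,3)[OF assms(1)])

lemma subrep_scal_cancel:
  assumes "subrepr W" "scal z f \<in> W" "z \<noteq> 0"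
  shows "f \<in> W"
proof -
  have "scal (inverse z) (scal z f) = f"
    using assms(3) sc_cancel[of z] by (simp add: lop_def)
  then show ?thesis
    using subrepD(4)[OF assms(1,2), of "inverse z"] by simp
qed

lemma subrep_Inter:
  assumes "\<And>U. U \<in> \<U> \<Longrightarrow> subrepr U" "\<U> \<noteq> {}"
  shows "subrepr (\<Inter>\<U>)"
proof (rule subrepI)
  show "\<Inter>\<U> \<subseteq> Vp"
    using subrepD(1)[OF assms(1)] assms(2) by blast
  show "0 \<in> \<Inter>\<U>"
    by (rule InterI) (rule subrepD(2)[OF assms(1)])
  show "f + g \<in> \<Inter>\<U>" if "f \<in> \<Inter>\<U>" "g \<in> \<Inter>\<U>" for f g
    by (rule InterI) (rule subrepD(3)[OF assms(1) InterD[OF that(1)] InterD[OF that(2)]])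
  show "scal z f \<in> \<Inter>\<U>" if "f \<in> \<Inter>\<U>" for z f
    by (rule InterI) (rule subrepD(4)[OF assms(1) InterD[OF that(1)]])
  show "a f \<in> \<Inter>\<U>" if "a \<in> \<N>" "f \<in> \<Inter>\<U>" for a f
    by (rule InterI) (rule subrepD(5)[OF assms(1) that(1) InterD[OF that(2)]])
  show "rop c f \<in> \<Inter>\<U>" if "f \<in> \<Inter>\<U>" for c f
    by (rule InterI) (rule subrepD(6)[OF assms(1) InterD[OF that(1)]])
qed

lemma subrep_Int: "subrepr W \<Longrightarrow> subrepr W' \<Longrightarrow> subrepr (W \<inter> W')"
  using subrep_Inter[of "{W, W'}"] by auto

lemma subrep_Vp: "subrepr Vp"
proof (rule subrepI)
  show "scal z f \<in> Vp" if "f \<in> Vp" for z f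
    using that by (simp add: V_plus_iff Vsp_lop scal_commute lop.zero)
  show "f + g \<in> Vp" if "f \<in> Vp" "g \<in> Vp" for f g
    using that by (simp add: V_plus_iff Vsp_add Dirac.add)
  show "0 \<in> Vp"
    by (simp add: V_plus_iff Vsp_zero Dirac.zero)
  show "a f \<in> Vp" if "a \<in> \<N>" "f \<in> Vp" for a f
    by (rule Nrm_V_plus[OF that])
  show "rop c f \<in> Vp" if "f \<in> Vp" for c f
    by (rule rop_V_plus[OF that])
qed simp

lemma irred_iff: "irred W \<longleftrightarrow> subrepr W \<and> W \<noteq> {0} \<and> (\<forall>U. subrepr U \<and> U \<subseteq> W \<longrightarrow> U = {0} \<or> U = W)"
  unfolding irred_subrep_def zero_fun_def ..

lemma cl_subrepD:
  assumes "cl_subrep J"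
  shows "0 \<in> J" "x \<in> J \<Longrightarrow> y \<in> J \<Longrightarrow> x + y \<in> J" "x \<in> J \<Longrightarrow> a * x \<in> J" "x \<in> J \<Longrightarrow> x * a \<in> J"
proof -
  note * = assms[unfolded cl_subrep_def]
  show "0 \<in> J" "x \<in> J \<Longrightarrow> y \<in> J \<Longrightarrow> x + y \<in> J"
    using * by simp_all
  have *: "x \<in> J \<Longrightarrow> a * x * b \<in> J" for a b
    using * by simp
  show "x \<in> J \<Longrightarrow> a * x \<in> J" "x \<in> J \<Longrightarrow> x * a \<in> J"
    using *[of a 1] *[of 1 a] by simp_all
qed

text \<open>Each generator only reindexes coefficients or multiplies them on the left by a ring
  element, the integer factors of \<open>dop\<close> included.\<close>

lemma WC_coeffs_ideal:
  assumes "a \<in> \<W>" "cl_subrep J" "range f \<subseteq> J"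
  shows "range (a f) \<subseteq> J"
  using assms(1,3)
proof (induction arbitrary: f rule: WC.induct)
  case (WC_x i)
  then show ?case
    using cl_subrepD(1)[OF assms(2)] by (auto simp: xop_def)
next
  case (WC_d i)
  then show ?case
    unfolding dop_def by (auto intro: cl_subrepD(3)[OF assms(2)])
next
  case (WC_g i)
  then show ?case
    unfolding lop_def by (auto intro: cl_subrepD(3)[OF assms(2)])
next
  case (WC_scal a z)
  then have "range (a f) \<subseteq> J" by simp
  then show ?case
    unfolding lop_def comp_def by (auto intro: cl_subrepD(3)[OF assms(2)])
next
  case (WC_add a b)
  then have "range (a f) \<subseteq> J" "range (b f) \<subseteq> J" by simp_all
  then show ?case
    by (auto intro: cl_subrepD(2)[OF assms(2)])
qed simp_all

lemma subrep_ideal_sub: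
  assumes "cl_subrep J"
  shows "subrepr (ideal_sub J)"
proof (rule subrepI)
  note V = subrepD[OF subrep_Vp] and J = cl_subrepD[OF assms]
  show "ideal_sub J \<subseteq> Vp"
    by (auto simp: ideal_sub_def)
  show "0 \<in> ideal_sub J"
    using V(2) J(1) by (simp add: ideal_sub_def)
  fix f assume "f \<in> ideal_sub J"
  then have f': "f \<in> Vp" "\<And>\<alpha>. f \<alpha> \<in> J"
    by (simp_all add: ideal_sub_def)
  show "f + g \<in> ideal_sub J" if "g \<in> ideal_sub J" for g
    using that V(3)[of f g] f' J(2) by (simp add: ideal_sub_def)
  show "scal z f \<in> ideal_sub J" for z
    using V(4)[OF f'(1), of z] J(3)[OF f'(2)] by (simp add: ideal_sub_def) (simp add: lop_def)
  show "a f \<in> ideal_sub J" if "a \<in> \<N>" for a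
    using V(5)[OF that f'(1)] WC_coeffs_ideal[OF Nrm_WC[OF that] assms, of f] f'(2)
    by (auto simp: ideal_sub_def)
  show "rop c f \<in> ideal_sub J" for c
    using V(6)[OF f'(1), of c] J(4)[OF f'(2)] by (simp add: ideal_sub_def) (simp add: rop_def)
qed

lemma const_Vp: "const c \<in> Vp"
  by (simp add: V_plus_iff const_Vsp Dirac_apply dop_const lop.zero)

lemma coef_ideal_sub:
  assumes "cl_subrep J"
  shows "coef_ideal (ideal_sub J) = J"
proof -
  have "(\<forall>\<alpha>. const c \<alpha> \<in> J) \<longleftrightarrow> c \<in> J" for c
    using cl_subrepD(1)[OF assms] by (auto simp: const_def)
  then show ?thesis
    by (simp add: coef_ideal_def ideal_sub_def const_Vp)
qed

text \<open>The factor \<open>n - 2\<close> in the action of \<^const>\<open>gam_hat\<close> on constants is the reason for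
  excluding \<open>n = 2\<close>.\<close>

lemma subrep_const_left:
  assumes "n \<noteq> 2" "subrepr W" "const c \<in> W"
  shows "const (a * c) \<in> W"
proof (induction a rule: Cl_induct)
  case one
  then show ?case using assms(3) by simp
next
  case (gen i a)
  have "scal (of_nat n - 2) (const (gam i * a * c)) \<in> W"
    using subrepD(5)[OF assms(2) gam_hat_Nrm[OF gen(1)] gen(2)]
    by (simp add: gam_hat_const[OF gen(1)] lop_const mult.assoc)
  moreover have "of_nat n - 2 \<noteq> (0::complex)"
    using assms(1) by (metis eq_iff_diff_eq_0 of_nat_eq_iff of_nat_numeral)
  ultimately show ?case
    by (rule subrep_scal_cancel[OF assms(2)])
next
  case (scale z a)
  then show ?case
    using subrepD(4)[OF assms(2), of "const (a * c)" z] by (simp add: lop_const mult.assoc)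
next
  case (plus a b)
  then show ?case
    unfolding distrib_right const_add by (rule subrepD(3)[OF assms(2)])
qed

lemma cl_subrep_coef:
  assumes "n \<noteq> 2" "subrepr W"
  shows "cl_subrep (coef_ideal W)"
  unfolding cl_subrep_def
proof (intro conjI ballI allI)
  note W = subrepD[OF assms(2)]
  show "0 \<in> coef_ideal W"
    using W(2) by (simp add: coef_ideal_def const_zero)
  show "x + y \<in> coef_ideal W" if "x \<in> coef_ideal W" "y \<in> coef_ideal W" for x y
    using W(3)[of "const x" "const y"] that unfolding coef_ideal_def const_add[symmetric] by simp
  show "a * x * b \<in> coef_ideal W" if "x \<in> coef_ideal W" for a x b
    using W(6)[OF subrep_const_left[OF assms, of x a], of b] that
    by (simp add: coef_ideal_def rop_const)
qed

section \<open>Descent to constants and the correspondence of minimal objects\<close>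

lemma degree_upd:
  assumes "i < n"
  shows "(\<Sum>j<n. (\<alpha>(i := Suc (\<alpha> i))) j) = Suc (\<Sum>j<n. \<alpha> j)"
proof -
  have "(\<Sum>j<n. (\<alpha>(i := Suc (\<alpha> i))) j) = (\<Sum>j<n. \<alpha> j + (if j = i then 1 else 0))"
    by (intro sum.cong) auto
  then show ?thesis
    using assms by (simp add: sum.distrib)
qed

lemma eq_const_degree_0:
  fixes f :: "(nat \<Rightarrow> nat) \<Rightarrow> 'c"
  assumes "f \<in> Vsp n" "\<And>\<alpha>. f \<alpha> \<noteq> 0 \<Longrightarrow> (\<Sum>i<n. \<alpha> i) = 0"
  shows "f = const (f (\<lambda>_. 0))"
proof
  fix \<alpha>
  show "f \<alpha> = const (f (\<lambda>_. 0)) \<alpha>"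
  proof (cases "f \<alpha> = 0")
    case False
    have "\<alpha> i = 0" for i
      using assms(2)[OF False] Vsp_vanish[OF assms(1) False, of i] by (cases "i < n") simp_all
    then have "\<alpha> = (\<lambda>_. 0)" by auto
    then show ?thesis by (simp add: const_def)
  qed (auto simp: const_def)
qed

lemma eq_const_dop_0:
  fixes f :: "(nat \<Rightarrow> nat) \<Rightarrow> 'c"
  assumes "f \<in> Vsp n" "\<And>i. i < n \<Longrightarrow> dop i f = 0"
  shows "f = const (f (\<lambda>_. 0))"
proof (rule eq_const_degree_0[OF assms(1)])
  fix \<alpha> assume f: "f \<alpha> \<noteq> 0"
  have "\<alpha> i = 0" if "i < n" for i
  proof (rule ccontr)
    assume "\<alpha> i \<noteq> 0"
    \<comment> \<open>Evaluating the derivative at the exponent lowered by one returns the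
      coefficient at alpha times the positive integer alpha i, which is cancellable.\<close>
    then have "dop i f (\<alpha>(i := \<alpha> i - 1)) = of_nat (\<alpha> i) * f \<alpha>"
      by (simp add: dop_def del: of_nat_Suc)
    then show False
      using assms(2)[OF that] f \<open>\<alpha> i \<noteq> 0\<close> of_nat_mult_eq_0_iff[of "\<alpha> i" "f \<alpha>"] by simp
  qed
  then show "(\<Sum>i<n. \<alpha> i) = 0" by simp
qed

lemma subrep_exists_const:
  assumes "subrepr W" "f \<in> W" "f \<noteq> 0"
  obtains c where "c \<noteq> 0" "const c \<in> W"
proof -
  have V: "g \<in> Vsp n" if "g \<in> W" for g
    using that subrepD(1)[OF assms(1)] by (auto simp: V_plus_iff)
  have "\<exists>c. c \<noteq> 0 \<and> const c \<in> W"
    if "g \<in> W" "g \<noteq> 0" "\<And>\<alpha>. g \<alpha> \<noteq> 0 \<Longrightarrow> (\<Sum>i<n. \<alpha> i) < N" for g N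
    using that
  proof (induction N arbitrary: g)
    case 0
    then show ?case by (auto simp: fun_eq_iff)
  next
    case (Suc N)
    show ?case
    proof (cases "\<exists>i<n. dop i g \<noteq> 0")
      case True
      then obtain i where i: "i < n" "dop i g \<noteq> 0" by blast
      show ?thesis
      proof (rule Suc.IH[OF _ i(2)])
        show "dop i g \<in> W"
          by (rule subrepD(5)[OF assms(1) dop_Nrm[OF i(1)] Suc.prems(1)])
        show "(\<Sum>j<n. \<alpha> j) < N" if "dop i g \<alpha> \<noteq> 0" for \<alpha>
        proof -
          have "g (\<alpha>(i := Suc (\<alpha> i))) \<noteq> 0"
            using that by (auto simp: dop_def)
          from Suc.prems(3)[OF this] show ?thesis
            unfolding degree_upd[OF i(1)] by simp
        qed
      qed
    next
      case False
      then have g: "g = const (g (\<lambda>_. 0))"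
        by (intro eq_const_dop_0 V Suc.prems(1)) blast
      then have "g (\<lambda>_. 0) \<noteq> 0"
        using Suc.prems(2) const_zero by metis
      then show ?thesis
        using Suc.prems(1) g by metis
    qed
  qed
  moreover have "(\<Sum>i<n. \<alpha> i) < Suc (Max ((\<lambda>\<alpha>. \<Sum>i<n. \<alpha> i) ` {\<alpha>. f \<alpha> \<noteq> 0}))" if "f \<alpha> \<noteq> 0" for \<alpha>
    using that Vsp_finite[OF V[OF assms(2)]] by (intro le_imp_less_Suc Max_ge) auto
  ultimately show thesis
    using that assms(2,3) by metis
qed

lemma coef_ideal_nonzero:
  assumes "subrepr W" "W \<noteq> {0}"
  shows "coef_ideal W \<noteq> {0}"
proof -
  obtain f where "f \<in> W" "f \<noteq> 0"
    using assms(2) subrepD(2)[OF assms(1)] by blast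
  then show ?thesis
    using subrep_exists_const[OF assms(1)] unfolding coef_ideal_def by blast
qed

lemma coef_zero: "coef_ideal {0} = {0}"
proof -
  have "const c = 0 \<longleftrightarrow> c = 0" for c :: 'c
  proof
    assume "const c = 0"
    then have "const c (\<lambda>_. 0) = 0" by simp
    then show "c = 0" by (simp add: const_def)
  qed (simp add: const_zero)
  then show ?thesis by (simp add: coef_ideal_def)
qed

lemma cl_irred_coef:
  assumes "n \<noteq> 2" "irred W"
  shows "cl_irred (coef_ideal W)"
  unfolding cl_irred_def
proof (intro conjI allI impI)
  have W: "subrepr W" "W \<noteq> {0}" "\<And>U. subrepr U \<Longrightarrow> U \<subseteq> W \<Longrightarrow> U = {0} \<or> U = W"
    using assms(2) unfolding irred_iff by blast+
  show "cl_subrep (coef_ideal W)"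
    by (rule cl_subrep_coef[OF assms(1) W(1)])
  show "coef_ideal W \<noteq> {0}"
    by (rule coef_ideal_nonzero[OF W(1,2)])
  fix J assume J: "cl_subrep J \<and> J \<subseteq> coef_ideal W"
  \<comment> \<open>The constants of \<open>ideal_sub J\<close> are exactly J, and J already lies
    among the constants of W. Minimality of W applied to the intersection thus transfers to
    J.\<close>
  then have "coef_ideal (W \<inter> ideal_sub J) = J"
    using coef_ideal_sub[of J] unfolding coef_ideal_def by blast
  moreover have "W \<inter> ideal_sub J = {0} \<or> W \<inter> ideal_sub J = W"
    using J by (intro W(3) subrep_Int W(1) subrep_ideal_sub) auto
  ultimately show "J = {0} \<or> J = coef_ideal W"
    using coef_zero by metis
qed

text \<open>A common nonzero constant makes the intersection a nonzero subrepresentation of both, so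
  by minimality it equals each of them.\<close>

lemma irred_coef_inj:
  assumes "irred W" "irred W'" "coef_ideal W = coef_ideal W'"
  shows "W = W'"
proof -
  have W: "subrepr W" "W \<noteq> {0}" "\<And>U. subrepr U \<Longrightarrow> U \<subseteq> W \<Longrightarrow> U = {0} \<or> U = W"
    using assms(1) unfolding irred_iff by blast+
  have W': "subrepr W'" "\<And>U. subrepr U \<Longrightarrow> U \<subseteq> W' \<Longrightarrow> U = {0} \<or> U = W'"
    using assms(2) unfolding irred_iff by blast+
  have "coef_ideal (W \<inter> W') = coef_ideal W"
    using assms(3) unfolding coef_ideal_def by blast
  then have "W \<inter> W' \<noteq> {0}"
    using coef_ideal_nonzero[OF W(1,2)] coef_zero by metis
  then show ?thesis
    using W(3)[OF subrep_Int[OF W(1) W'(1)]] W'(2)[OF subrep_Int[OF W(1) W'(1)]] by blast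
qed

text \<open>The subrepresentation generated by the constants in a minimal ideal \<open>J\<close> is irreducible, since
  every nonzero subrepresentation of it contains constants, hence all of \<open>J\<close>.\<close>

lemma irred_coef_surj:
  assumes "n \<noteq> 2" "cl_irred J"
  obtains W where "irred W" "coef_ideal W = J"
proof -
  have J: "cl_subrep J" "J \<noteq> {0}" "\<And>J'. cl_subrep J' \<Longrightarrow> J' \<subseteq> J \<Longrightarrow> J' = {0} \<or> J' = J"
    using assms(2) unfolding cl_irred_def by blast+
  define W where "W = \<Inter> {U. subrepr U \<and> const ` J \<subseteq> U}"
  have "const ` J \<subseteq> ideal_sub J"
    using coef_ideal_sub[OF J(1)] unfolding coef_ideal_def by blast
  \<comment> \<open>\<open>ideal_sub J\<close> is one of the sets being intersected. This keeps the
    generated subrepresentation from acquiring constants outside J.\<close>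
  then have WJ: "W \<subseteq> ideal_sub J"
    unfolding W_def using subrep_ideal_sub[OF J(1)] by blast
  have "subrepr W"
    unfolding W_def
  proof (rule subrep_Inter)
    show "{U. subrepr U \<and> const ` J \<subseteq> U} \<noteq> {}"
      using \<open>const ` J \<subseteq> ideal_sub J\<close> subrep_ideal_sub[OF J(1)] by blast
  qed simp
  moreover have coef: "coef_ideal W = J"
  proof
    show "coef_ideal W \<subseteq> J"
      using WJ coef_ideal_sub[OF J(1)] unfolding coef_ideal_def by blast
    show "J \<subseteq> coef_ideal W"
      unfolding coef_ideal_def W_def by blast
  qed
  moreover have "W \<noteq> {0}"
    using coef coef_zero J(2) by metis
  moreover have "U = {0} \<or> U = W" if U: "subrepr U" "U \<subseteq> W" for U
  proof (cases "U = {0}")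
    case False
    have "coef_ideal U \<subseteq> J"
      using U(2) coef unfolding coef_ideal_def by blast
    then have "coef_ideal U = J"
      using J(3)[OF cl_subrep_coef[OF assms(1) U(1)]] coef_ideal_nonzero[OF U(1) False] by blast
    then have "const ` J \<subseteq> U"
      unfolding coef_ideal_def by blast
    then have "W \<subseteq> U"
      using U(1) unfolding W_def by blast
    then show ?thesis using U(2) by blast
  qed simp
  ultimately show thesis
    using that unfolding irred_iff by blast
qed

lemma bij_betw_irred:
  assumes "n \<noteq> 2"
  shows "bij_betw coef_ideal {W. irred W} {J. cl_irred J}"
  unfolding bij_betw_def
proof
  show "inj_on coef_ideal {W. irred W}"
    by (rule inj_onI, rule irred_coef_inj) simp_all
  show "coef_ideal ` {W. irred W} = {J. cl_irred J}"
    using cl_irred_coef[OF assms] irred_coef_surj[OF assms] by (auto simp: image_iff) metis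
qed

section \<open>Generation by constants\<close>

definition hom_part :: "nat \<Rightarrow> ((nat \<Rightarrow> nat) \<Rightarrow> 'c) \<Rightarrow> ((nat \<Rightarrow> nat) \<Rightarrow> 'c)" where
  "hom_part d f = (\<lambda>\<alpha>. if (\<Sum>i<n. \<alpha> i) = d then f \<alpha> else 0)"

lemma dop_hom_part:
  "i < n \<Longrightarrow> dop i (hom_part d f) = (\<lambda>\<alpha>. if Suc (\<Sum>i<n. \<alpha> i) = d then dop i f \<alpha> else 0)"
  unfolding dop_def hom_part_def by (simp only: degree_upd if_distrib mult_zero_right)

text \<open>\<open>Dirac\<close> lowers the degree by exactly one, so it maps a homogeneous
  component of f to a component of \<open>Dirac f\<close>.\<close>

lemma hom_part_Vp:
  assumes "f \<in> Vp"
  shows "hom_part d f \<in> Vp"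
proof -
  have f: "f \<in> Vsp n" "Dirac f = 0"
    using assms by (simp_all add: V_plus_iff)
  have "hom_part d f \<in> Vsp n"
    by (rule Vsp_I[OF Vsp_finite[OF f(1)]])
      (auto simp: hom_part_def Vsp_vanish[OF f(1)] split: if_splits)
  moreover have "Dirac (hom_part d f) \<alpha> = (if Suc (\<Sum>i<n. \<alpha> i) = d then Dirac f \<alpha> else 0)" for \<alpha>
    by (simp add: Dirac_apply sum_fun_eval dop_hom_part lop_def)
  ultimately show ?thesis
    by (simp add: V_plus_iff f(2) fun_eq_iff)
qed

lemma Euler_hom_part: "Euler (hom_part d f) = scal (of_nat d) (hom_part d f)"
  by (rule ext) (simp add: Euler_degree lop_def sc_of_nat hom_part_def del: of_nat_sum)

lemma sum_hom_part:
  fixes f :: "(nat \<Rightarrow> nat) \<Rightarrow> 'c"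
  assumes "f \<in> Vsp n"
  shows "f = (\<Sum>d\<in>(\<lambda>\<alpha>. \<Sum>i<n. \<alpha> i) ` {\<alpha>. f \<alpha> \<noteq> 0}. hom_part d f)"
proof
  fix \<alpha>
  show "f \<alpha> = (\<Sum>d\<in>(\<lambda>\<alpha>. \<Sum>i<n. \<alpha> i) ` {\<alpha>. f \<alpha> \<noteq> 0}. hom_part d f) \<alpha>"
    using Vsp_finite[OF assms] by (auto simp: sum_fun_eval hom_part_def)
qed

text \<open>Induction on the degree: the derivatives lie in U, and applying the \<open>x_hat\<close>
  operators to them and summing returns f up to the scalar \<open>Suc d * (2 * d + n)\<close>,
  nonzero because n is positive.\<close>

lemma homogeneous_generated:
  assumes "n \<ge> 1" "subrepr U" "\<And>c. const c \<in> U" "f \<in> Vp" "Euler f = scal (of_nat d) f"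
  shows "f \<in> U"
  using assms(4,5)
proof (induction d arbitrary: f)
  case 0
  have "f = const (f (\<lambda>_. 0))"
  proof (rule eq_const_degree_0)
    show "f \<in> Vsp n"
      using 0 by (simp add: V_plus_iff)
    show "(\<Sum>i<n. \<alpha> i) = 0" if "f \<alpha> \<noteq> 0" for \<alpha>
    proof -
      have "of_nat (\<Sum>i<n. \<alpha> i) * f \<alpha> = 0"
        using fun_cong[OF 0(2), of \<alpha>] unfolding Euler_degree by simp
      then show ?thesis
        using that of_nat_mult_eq_0_iff by blast
    qed
  qed
  then show ?case
    using assms(3)[of "f (\<lambda>_. 0)"] by simp
next
  case (Suc d)
  have "dop i f \<in> U" if "i < n" for i
    by (rule Suc.IH[OF Nrm_V_plus[OF dop_Nrm[OF that] Suc.prems(1)] Euler_dop_eigen[OF Suc.prems(2) that]])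
  then have "x_hat i (dop i f) \<in> U" if "i < n" for i
    using that by (intro subrepD(5)[OF assms(2) x_hat_Nrm[OF that]])
  then have "(\<Sum>i<n. x_hat i (dop i f)) \<in> U"
    by (intro subrep_sum[OF assms(2)]) simp
  then have "scal (of_nat (Suc d * (2 * d + n))) f \<in> U"
    unfolding sum_x_hat_dop[OF Suc.prems] .
  then show ?case
    by (rule subrep_scal_cancel[OF assms(2)]) (use assms(1) in \<open>simp only: of_nat_eq_0_iff mult_eq_0_iff add_eq_0_iff_both_eq_0\<close>, simp)
qed

lemma Vp_generated:
  assumes "n \<ge> 1" "subrepr U" "\<And>c. const c \<in> U"
  shows "U = Vp"
proof
  show "U \<subseteq> Vp"
    by (rule subrepD(1)[OF assms(2)])
  show "Vp \<subseteq> U"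
  proof
    fix f assume "f \<in> Vp"
    have "sum (\<lambda>d. hom_part d f) A \<in> U" for A
      by (intro subrep_sum[OF assms(2)] homogeneous_generated[OF assms _ Euler_hom_part]
          hom_part_Vp \<open>f \<in> Vp\<close>)
    then show "f \<in> U"
      using sum_hom_part[of f] \<open>f \<in> Vp\<close> by (metis V_plus_iff)
  qed
qed

lemma irred_Vp:
  assumes "n \<ge> 1" "n \<noteq> 2" and simple: "\<And>J::'c set. cl_subrep J \<Longrightarrow> J \<noteq> {0} \<Longrightarrow> 1 \<in> J"
  shows "irred Vp"
  unfolding irred_iff
proof (intro conjI allI impI)
  show "subrepr Vp"
    by (rule subrep_Vp)
  show "Vp \<noteq> {0}"
    using const_Vp[of 1] by (metis coef_ideal_def coef_zero mem_Collect_eq singletonD zero_neq_one)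
  fix U assume U: "subrepr U \<and> U \<subseteq> Vp"
  show "U = {0} \<or> U = Vp"
  proof (cases "U = {0}")
    case False
    have ideal: "cl_subrep (coef_ideal U)" "coef_ideal U \<noteq> {0}"
      using U False by (simp_all add: cl_subrep_coef assms(2) coef_ideal_nonzero)
    have "c \<in> coef_ideal U" for c
      using cl_subrepD(3)[OF ideal(1) simple[OF ideal], of c] by simp
    then have "U = Vp"
      using U by (intro Vp_generated assms(1)) (simp_all add: coef_ideal_def)
    then show ?thesis ..
  qed simp
qed

section \<open>Simplicity of the Clifford algebra in even dimension\<close>

text \<open>Gives access to dimension arguments: the exchange bound limits the size of orthonormal
  families and forces a spanning one to have n elements.\<close>

sublocale vec: vector_space "\<lambda>z c. sc z * c"
  by standard (simp_all add: distrib_left sc_add distrib_right sc_mult mult.assoc)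

text \<open>The coefficients are indexed by I instead of by the vectors, so \<open>g\<close> may
  repeat values.\<close>

lemma span_family:
  assumes "finite I" "v \<in> vec.span (g ` I)"
  obtains a where "v = (\<Sum>i\<in>I. sc (a i) * g i)"
proof -
  have "\<exists>a. v = (\<Sum>i\<in>I. sc (a i) * g i)"
    using assms(2)
  proof (induction rule: vec.span_induct_alt)
    case base
    show ?case by (intro exI[of _ "\<lambda>_. 0"]) simp
  next
    case (step c x y)
    then obtain i a where i: "i \<in> I" "x = g i" and y: "y = (\<Sum>i\<in>I. sc (a i) * g i)" by blast
    have "(\<Sum>j\<in>I. sc (a j + (if j = i then c else 0)) * g j)
        = (\<Sum>j\<in>I. sc (a j) * g j + (if j = i then sc c * g i else 0))"
      by (intro sum.cong) (auto simp: sc_add distrib_right)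
    also have "\<dots> = sc c * x + y"
      using i assms(1) by (simp add: sum.distrib y)
    finally show ?case by metis
  qed
  then show thesis using that by blast
qed

abbreviation "gam_span \<equiv> vec.span (gam ` {..<n})"

lemma anticomm_linear: "(sc c * x + y) * w + w * (sc c * x + y) = sc c * (x * w + w * x) + (y * w + w * y)"
  by (simp add: distrib_left distrib_right mult.assoc sc_left_commute[of w])

lemma anticomm_sum:
  "(\<Sum>i\<in>I. sc (a i) * g i) * w + w * (\<Sum>i\<in>I. sc (a i) * g i) = (\<Sum>i\<in>I. sc (a i) * (g i * w + w * g i))"
  by (simp add: sum_distrib_left sum_distrib_right sum.distrib distrib_left mult.assoc sc_left_commute[of w])

lemma anticomm_scalar:
  assumes "v \<in> gam_span" "w \<in> gam_span"
  shows "\<exists>b. v * w + w * v = sc b"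
proof -
  \<comment> \<open>The same induction serves both arguments of the bilinear form: first to pair a
    general vector with a generator, then to pair two general vectors.\<close>
  have gen: "\<exists>b. v * w + w * v = sc b"
    if v: "v \<in> gam_span" and w: "\<And>i. i < n \<Longrightarrow> \<exists>b. gam i * w + w * gam i = sc b" for v w
    using v
  proof (induction rule: vec.span_induct_alt)
    case base
    show ?case by (intro exI[of _ 0]) simp
  next
    case (step c x y)
    then obtain b b' where "x * w + w * x = sc b'" "y * w + w * y = sc b"
      using w by blast
    then have "(sc c * x + y) * w + w * (sc c * x + y) = sc (c * b' + b)"
      by (simp only: anticomm_linear sc_add sc_mult)
    then show ?case by blast
  qed
  have "\<exists>b. gam i * w + w * gam i = sc b" if "i < n" for i
  proof -
    have "\<exists>b. w * gam i + gam i * w = sc b"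
      by (rule gen[OF assms(2)]) (use gam_anticomm that in blast)
    then show ?thesis by (simp add: add.commute)
  qed
  then show ?thesis
    by (rule gen[OF assms(1)])
qed

lemma square_scalar:
  assumes "v \<in> gam_span"
  shows "\<exists>q. v * v = sc q"
proof -
  obtain b where "v * v + v * v = sc b"
    using anticomm_scalar[OF assms assms] by blast
  then have "sc 2 * (v * v) = sc b"
    by (simp add: mult_2)
  then have "v * v = sc (inverse 2 * b)"
    using sc_cancel[of 2 "v * v"] by (simp only: sc_mult zero_neq_numeral[symmetric] not_False_eq_True simp_thms)
  then show ?thesis by blast
qed

lemma sc_eq_0_iff: "sc z = 0 \<longleftrightarrow> z = 0"
  using sc_mult_eq_0_iff[of z 1] by simp

text \<open>Anticommuting with all \<open>gam j\<close> says that the coefficient row times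
  \<open>eta\<close> vanishes; multiplication by \<open>etainv\<close> from the right recovers the
  row.\<close>

lemma nondegenerate_coeffs:
  assumes v: "v = (\<Sum>i<n. sc (a i) * gam i)" "\<And>j. j < n \<Longrightarrow> v * gam j + gam j * v = 0" and k: "k < n"
  shows "a k = 0"
proof -
  have zero: "(\<Sum>i<n. a i * eta i j) = 0" if "j < n" for j
  proof -
    have "v * gam j + gam j * v = (\<Sum>i<n. sc (a i) * (gam i * gam j + gam j * gam i))"
      unfolding v(1) by (rule anticomm_sum)
    also have "\<dots> = (\<Sum>i<n. sc (2 * (a i * eta i j)))"
    proof (intro sum.cong refl)
      fix i assume "i \<in> {..<n}"
      then show "sc (a i) * (gam i * gam j + gam j * gam i) = sc (2 * (a i * eta i j))"
        using gam_anticomm[of i j] that by (simp only: lessThan_iff sc_mult[symmetric] mult.left_commute)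
    qed
    finally have "sc (\<Sum>i<n. 2 * (a i * eta i j)) = 0"
      using v(2)[OF that] by (simp only: sc.sum)
    then show ?thesis
      unfolding sc_eq_0_iff sum_distrib_left[symmetric] by simp
  qed
  have "a k = (\<Sum>i<n. a i * (\<Sum>j<n. eta i j * etainv j k))"
    using k by (simp add: eta_inv if_distrib[of "\<lambda>x. _ * x"] cong: if_cong)
  also have "\<dots> = (\<Sum>i<n. \<Sum>j<n. a i * eta i j * etainv j k)"
    by (simp add: sum_distrib_left mult.assoc)
  also have "\<dots> = (\<Sum>j<n. \<Sum>i<n. a i * eta i j * etainv j k)"
    by (rule sum.swap)
  also have "\<dots> = (\<Sum>j<n. (\<Sum>i<n. a i * eta i j) * etainv j k)"
    by (simp add: sum_distrib_right)
  also have "\<dots> = 0"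
    by (simp add: zero)
  finally show ?thesis .
qed

lemma nondegenerate:
  assumes "v \<in> gam_span" "\<And>j. j < n \<Longrightarrow> v * gam j + gam j * v = 0"
  shows "v = 0"
proof -
  obtain a where a: "v = (\<Sum>i<n. sc (a i) * gam i)"
    using span_family[OF _ assms(1)] by blast
  have "a i = 0" if "i < n" for i
    by (rule nondegenerate_coeffs[OF a assms(2) that])
  then show ?thesis
    by (simp add: a)
qed

text \<open>The vector 0 anticommutes with everything, so linear independence of the generators is a
  case of nondegeneracy.\<close>

lemma gam_coeffs_zero: "(\<Sum>i<n. sc (a i) * gam i) = 0 \<Longrightarrow> k < n \<Longrightarrow> a k = 0"
  by (rule nondegenerate_coeffs[of 0]) simp_all

lemma inj_gam: "inj_on gam {..<n}"
proof (rule inj_onI)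
  fix i j assume ij: "i \<in> {..<n}" "j \<in> {..<n}" "gam i = gam j"
  show "i = j"
  proof (rule ccontr)
    assume "i \<noteq> j"
    let ?a = "\<lambda>k. (if k = i then 1 else 0) - (if k = j then 1 else 0)"
    have "(\<Sum>k<n. sc (?a k) * gam k) = (\<Sum>k<n. (if k = i then gam i else 0) - (if k = j then gam j else 0))"
      by (intro sum.cong refl) (auto simp: sc.diff sc.minus)
    also have "\<dots> = 0"
      using ij by (simp add: sum_subtractf)
    finally show False
      using gam_coeffs_zero[of ?a i] ij(1) \<open>i \<noteq> j\<close> by simp
  qed
qed

lemma independent_gam: "vec.independent (gam ` {..<n})"
proof
  assume "vec.dependent (gam ` {..<n})"
  then have "\<exists>u. (\<exists>v\<in>gam ` {..<n}. u v \<noteq> 0) \<and> (\<Sum>v\<in>gam ` {..<n}. sc (u v) * v) = 0"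
    by (rule iffD1[OF vec.dependent_finite[OF finite_imageI[OF finite_lessThan]]])
  then obtain u i where u: "i < n" "u (gam i) \<noteq> 0" "(\<Sum>v\<in>gam ` {..<n}. sc (u v) * v) = 0"
    by (elim exE conjE bexE imageE) simp
  have "(\<Sum>i<n. sc (u (gam i)) * gam i) = 0"
    using u(3) unfolding sum.reindex[OF inj_gam] comp_def .
  from gam_coeffs_zero[OF this u(1)] u(2) show False
    by simp
qed

section \<open>Orthonormal bases for the form given by half the anticommutator\<close>

definition orthonormal :: "'c set \<Rightarrow> bool" where
  "orthonormal B \<longleftrightarrow> B \<subseteq> gam_span \<and> (\<forall>e\<in>B. e * e = 1) \<and> (\<forall>e\<in>B. \<forall>e'\<in>B. e \<noteq> e' \<longrightarrow> e * e' + e' * e = 0)"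

lemma orthonormalD:
  assumes "orthonormal B"
  shows "B \<subseteq> gam_span" "e \<in> B \<Longrightarrow> e * e = 1"
    "e \<in> B \<Longrightarrow> e' \<in> B \<Longrightarrow> e \<noteq> e' \<Longrightarrow> e * e' + e' * e = 0"
  using assms by (simp_all add: orthonormal_def)

lemma one_plus_one_nonzero: "(1::'c) + 1 \<noteq> 0"
  using sc_mult_eq_0_iff[of 2 1] by simp

lemma orthonormal_anticomm_sum:
  assumes "orthonormal B" "finite t" "t \<subseteq> B" "e \<in> t"
  shows "(\<Sum>v\<in>t. sc (u v) * v) * e + e * (\<Sum>v\<in>t. sc (u v) * v) = sc (2 * u e)"
proof -
  have "(\<Sum>v\<in>t. sc (u v) * v) * e + e * (\<Sum>v\<in>t. sc (u v) * v) = (\<Sum>v\<in>t. sc (u v) * (v * e + e * v))"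
    by (rule anticomm_sum)
  also have "\<dots> = (\<Sum>v\<in>t. if v = e then sc (2 * u e) else 0)"
  proof (intro sum.cong refl)
    fix v assume "v \<in> t"
    then have B: "v \<in> B" "e \<in> B"
      using assms(3,4) by blast+
    show "sc (u v) * (v * e + e * v) = (if v = e then sc (2 * u e) else 0)"
    proof (cases "v = e")
      case True
      then show ?thesis
        by (simp only: orthonormalD(2)[OF assms(1) B(2)] if_True simp_thms mult_2 sc_add distrib_left mult_1_right)
    next
      case False
      then show ?thesis
        by (simp add: orthonormalD(3)[OF assms(1) B])
    qed
  qed
  also have "\<dots> = sc (2 * u e)"
    using assms by simp
  finally show ?thesis .
qed

lemma orthonormal_independent:
  assumes "orthonormal B"
  shows "vec.independent B"
proof
  assume "vec.dependent B"
  then obtain t u e where t: "finite t" "t \<subseteq> B" "(\<Sum>v\<in>t. sc (u v) * v) = 0" "e \<in> t" "u e \<noteq> 0"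
    unfolding vec.dependent_explicit by blast
  from orthonormal_anticomm_sum[OF assms t(1,2,4), of u] have "sc (2 * u e) = 0"
    unfolding t(3) by simp
  then show False
    using t(5) unfolding sc_eq_0_iff by simp
qed

lemma orthonormal_card:
  assumes "orthonormal B"
  shows "finite B \<and> card B \<le> n"
proof -
  have "finite B \<and> card B \<le> card (gam ` {..<n})"
    using assms by (intro vec.independent_span_bound orthonormal_independent) (auto simp: orthonormal_def)
  then show ?thesis
    by (simp add: card_image[OF inj_gam])
qed

lemma orthonormal_insert:
  assumes "orthonormal B" "v \<in> gam_span" "v * v = sc q" "q \<noteq> 0" "\<And>e. e \<in> B \<Longrightarrow> v * e + e * v = 0"
  obtains B' where "orthonormal B'" "card B' = Suc (card B)"
proof -
  \<comment> \<open>Over the complex numbers every vector with nonzero square can be normalised to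
    square 1.\<close>
  define u where "u = sc (inverse (csqrt q)) * v"
  have "u * u = sc (inverse (csqrt q) * inverse (csqrt q)) * (v * v)"
    unfolding u_def by (simp only: sc_mult mult.assoc sc_left_commute[of v])
  also have "\<dots> = sc (inverse (csqrt q * csqrt q) * q)"
    by (simp only: assms(3) sc_mult inverse_mult_distrib)
  also have "csqrt q * csqrt q = q"
    using power2_csqrt[of q] by (simp only: power2_eq_square)
  finally have uu: "u * u = 1"
    using assms(4) by simp
  have ue: "u * e + e * u = 0" if "e \<in> B" for e
    using anticomm_linear[of "inverse (csqrt q)" v 0 e] assms(5)[OF that] by (simp add: u_def)
  have eu: "e * u + u * e = 0" if "e \<in> B" for e
    using ue[OF that] by (simp only: add.commute)
  \<comment> \<open>An element of B would have to anticommute with u; for u itself this would give 1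
    + 1 = 0.\<close>
  have "u \<notin> B"
  proof
    assume "u \<in> B"
    from ue[OF this] show False
      unfolding uu using one_plus_one_nonzero by simp
  qed
  then have "card (insert u B) = Suc (card B)"
    using orthonormal_card[OF assms(1)] by simp
  moreover have "u \<in> gam_span"
    unfolding u_def by (rule vec.span_scale[OF assms(2)])
  then have "orthonormal (insert u B)"
    using orthonormalD(1)[OF assms(1)] unfolding orthonormal_def
    by (auto simp: uu ue eu orthonormalD(2,3)[OF assms(1)])
  ultimately show thesis
    by (intro that)
qed

text \<open>An orthonormal family of largest size is taken. A vector orthogonal to it has square
  zero, as it could otherwise be normalised and adjoined. Polarisation then makes the form vanish on
  the whole orthogonal complement, and nondegeneracy makes that complement zero.\<close>

lemma orthonormal_basis:
  obtains B where "orthonormal B" "gam_span \<subseteq> vec.span B" "finite B" "card B = n"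
proof -
  have "orthonormal {}"
    by (simp add: orthonormal_def)
  moreover have "\<forall>B. orthonormal B \<longrightarrow> card B < Suc n"
    using orthonormal_card by (simp add: less_Suc_eq_le)
  ultimately have "\<exists>B. orthonormal B \<and> (\<forall>B'. orthonormal B' \<longrightarrow> card B' \<le> card B)"
    by (rule ex_has_greatest_nat)
  then obtain B where B: "orthonormal B" "\<And>B'. orthonormal B' \<Longrightarrow> card B' \<le> card B"
    by blast
  have fin: "finite B" and BG: "B \<subseteq> gam_span"
    using orthonormal_card[OF B(1)] B(1) by (auto simp: orthonormal_def)
  have isotropic: "v * v = 0" if v: "v \<in> gam_span" "\<And>e. e \<in> B \<Longrightarrow> v * e + e * v = 0" for v
  proof -
    obtain q where q: "v * v = sc q"
      using square_scalar[OF v(1)] by blast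
    have "q = 0"
    proof (rule ccontr)
      assume "q \<noteq> 0"
      obtain B' where "orthonormal B'" "card B' = Suc (card B)"
        using orthonormal_insert[OF B(1) v(1) q \<open>q \<noteq> 0\<close> v(2)] by metis
      then show False
        using B(2)[of B'] by simp
    qed
    then show ?thesis using q by simp
  qed
  have decomp: "\<exists>w\<in>vec.span B. \<forall>e\<in>B. (v - w) * e + e * (v - w) = 0" if v: "v \<in> gam_span" for v
  proof -
    have "\<forall>e\<in>B. \<exists>b. v * e + e * v = sc b"
      using anticomm_scalar[OF v] BG by blast
    then obtain b where b: "\<forall>e\<in>B. v * e + e * v = sc (b e)"
      using bchoice[of B "\<lambda>e b. v * e + e * v = sc b"] by blast
    \<comment> \<open>The orthogonal projection onto the span of B. Pairing by the anticommutator
      returns twice a coefficient, hence the division by 2.\<close>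
    define w where "w = (\<Sum>e\<in>B. sc (b e / 2) * e)"
    have "w \<in> vec.span B"
      unfolding w_def by (intro vec.span_sum vec.span_scale vec.span_base)
    moreover have "(v - w) * e + e * (v - w) = 0" if "e \<in> B" for e
    proof -
      have "w * e + e * w = sc (2 * (b e / 2))"
        unfolding w_def using orthonormal_anticomm_sum[OF B(1) fin order_refl that, of "\<lambda>e. b e / 2"] .
      then have "w * e + e * w = v * e + e * v"
        using b that by simp
      then show ?thesis
        unfolding left_diff_distrib right_diff_distrib add_diff_add[symmetric] by simp
    qed
    ultimately show ?thesis by blast
  qed
  have span: "gam_span \<subseteq> vec.span B"
  proof
    fix v assume v: "v \<in> gam_span"
    obtain w where w: "w \<in> vec.span B" "\<And>e. e \<in> B \<Longrightarrow> (v - w) * e + e * (v - w) = 0"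
      using decomp[OF v] by blast
    have wG: "w \<in> gam_span"
      using w(1) vec.span_minimal[OF BG vec.subspace_span] by blast
    have "v - w = 0"
    proof (rule nondegenerate)
      show "v - w \<in> gam_span"
        by (rule vec.span_diff[OF v wG])
      fix j assume "j < n"
      then have gj: "gam j \<in> gam_span"
        by (intro vec.span_base) simp
      then obtain y where y: "y \<in> vec.span B" "\<And>e. e \<in> B \<Longrightarrow> (gam j - y) * e + e * (gam j - y) = 0"
        using decomp by blast
      have yG: "y \<in> gam_span"
        using y(1) vec.span_minimal[OF BG vec.subspace_span] by blast
      define z where "z = gam j - y"
      have zG: "z \<in> gam_span" and z: "\<And>e. e \<in> B \<Longrightarrow> z * e + e * z = 0"
        unfolding z_def by (rule vec.span_diff[OF gj yG], rule y(2))
      define p where "p = v - w"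
      have pG: "p \<in> gam_span" and p: "\<And>e. e \<in> B \<Longrightarrow> p * e + e * p = 0"
        unfolding p_def by (rule vec.span_diff[OF v wG], rule w(2))
      have "p * p = 0" "z * z = 0"
        by (rule isotropic[OF pG p], assumption, rule isotropic[OF zG z])
      \<comment> \<open>Polarisation: p, z and p + z all have square zero, so p and z
        anticommute.\<close>
      moreover have "(p + z) * (p + z) = 0"
      proof (rule isotropic)
        show "p + z \<in> gam_span"
          by (rule vec.span_add[OF pG zG])
        show "(p + z) * e + e * (p + z) = 0" if "e \<in> B" for e
          using p[OF that] z[OF that] anticomm_linear[of 1 p z e] by simp
      qed
      ultimately have pz: "p * z + z * p = 0"
        by (simp add: distrib_left distrib_right add.commute[of "z * p"])
      \<comment> \<open>The other component of \<open>gam j\<close> lies in the span of B, to which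
        p is orthogonal.\<close>
      have "y * p + p * y = 0"
        using y(1)
      proof (induction rule: vec.span_induct_alt)
        case (step c x y)
        then have "x * p + p * x = 0"
          using p[of x] by (simp add: add.commute)
        then show ?case
          unfolding anticomm_linear using step.IH by simp
      qed simp
      then show "(v - w) * gam j + gam j * (v - w) = 0"
        using pz anticomm_linear[of 1 z y p] unfolding p_def[symmetric]
        by (simp add: z_def add.commute[of "p * _"])
    qed
    then show "v \<in> vec.span B"
      using w(1) by simp
  qed
  have "finite (gam ` {..<n}) \<and> card (gam ` {..<n}) \<le> card B"
    by (rule vec.independent_span_bound[OF fin independent_gam order_trans[OF vec.span_superset span]])
  then have "n \<le> card B"
    by (simp add: card_image[OF inj_gam])
  then show thesis
    using that[OF B(1) span fin] orthonormal_card[OF B(1)] by simp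
qed

text \<open>The monomials in an orthonormal basis are eigenvectors of the conjugations \<open>c \<mapsto> e i * c * e i\<close>
  with eigenvalues \<open>1\<close> and \<open>-1\<close>; projecting onto the common fixed vectors extracts the scalar part.\<close>

lemma ideal_extract_one:
  assumes J: "cl_subrep J" and e: "\<And>i. i < n \<Longrightarrow> e i * e i = 1"
    and F: "finite F" "T \<in> F" "k T \<noteq> 0" "w T = 1"
    and sign: "\<And>S i. S \<in> F \<Longrightarrow> i < n \<Longrightarrow> e i * w S * e i = w S \<or> e i * w S * e i = - w S"
    and sep: "\<And>S. S \<in> F \<Longrightarrow> S \<noteq> T \<Longrightarrow> \<exists>i<n. e i * w S * e i = - w S"
    and mem: "(\<Sum>S\<in>F. sc (k S) * w S) \<in> J"
  shows "1 \<in> J"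
  using F sign sep mem
proof (induction F rule: finite_psubset_induct)
  case (psubset F)
  show ?case
  proof (cases "F = {T}")
    case True
    then have "sc (k T) \<in> J"
      using psubset.prems(3,6) by simp
    from cl_subrepD(3)[OF J this, of "sc (inverse (k T))"] show ?thesis
      using sc_cancel[OF psubset.prems(2), of 1] by simp
  next
    case False
    then obtain S where S: "S \<in> F" "S \<noteq> T"
      using psubset.prems(1) by blast
    then obtain i where i: "i < n" "e i * w S * e i = - w S"
      using psubset.prems(5) by blast
    \<comment> \<open>Adding the conjugate by \<open>e i\<close> doubles the terms that are fixed
      and kills those that change sign. The term of T survives since \<open>w T\<close> is 1, and
      the term of S disappears, so the family shrinks strictly.\<close>
    define F' where "F' = {R \<in> F. e i * w R * e i \<noteq> - w R}"
    have "e i * w T * e i \<noteq> - w T"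
      using e[OF i(1)] one_plus_one_nonzero psubset.prems(3) by (simp add: eq_neg_iff_add_eq_0)
    then have T: "T \<in> F'"
      using psubset.prems(1) by (simp add: F'_def)
    let ?d = "\<Sum>R\<in>F. sc (k R) * w R"
    have "e i * ?d * e i = (\<Sum>R\<in>F. sc (k R) * (e i * w R * e i))"
      by (simp add: sum_distrib_left sum_distrib_right sc_left_commute[of "e i"] mult.assoc)
    then have "?d + e i * ?d * e i = (\<Sum>R\<in>F. sc (k R) * (w R + e i * w R * e i))"
      by (simp add: sum.distrib distrib_left)
    also have "\<dots> = (\<Sum>R\<in>F. if R \<in> F' then sc 2 * (sc (k R) * w R) else 0)"
    proof (intro sum.cong refl)
      fix R assume R: "R \<in> F"
      show "sc (k R) * (w R + e i * w R * e i) = (if R \<in> F' then sc 2 * (sc (k R) * w R) else 0)"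
        using psubset.prems(4)[OF R i(1)] R by (auto simp: F'_def distrib_left mult_2)
    qed
    also have "\<dots> = (\<Sum>R\<in>F'. sc 2 * (sc (k R) * w R))"
      using psubset.hyps by (subst sum.inter_filter[symmetric]) (auto simp: F'_def intro!: sum.cong)
    also have "\<dots> = sc 2 * (\<Sum>R\<in>F'. sc (k R) * w R)"
      by (simp only: sum_distrib_left)
    finally have eq: "?d + e i * ?d * e i = sc 2 * (\<Sum>R\<in>F'. sc (k R) * w R)" .
    have "?d + e i * ?d * e i \<in> J"
      by (intro cl_subrepD(2)[OF J] cl_subrepD(4)[OF J] cl_subrepD(3)[OF J] psubset.prems(6))
    from cl_subrepD(3)[OF J this, of "sc (inverse 2)"] have "(\<Sum>R\<in>F'. sc (k R) * w R) \<in> J"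
      unfolding eq by (simp only: sc_cancel[OF zero_neq_numeral[symmetric]])
    moreover have "F' \<subset> F"
      using S(1) i(2) by (auto simp: F'_def)
    ultimately show ?thesis
      using T psubset.prems(2-5) by (intro psubset.IH[of F']) (auto simp: F'_def)
  qed
qed

section \<open>Words in an orthonormal basis and the separation of monomials by signs\<close>

definition word :: "(nat \<Rightarrow> 'c) \<Rightarrow> nat list \<Rightarrow> 'c" where
  "word e xs = foldr (\<lambda>i acc. e i * acc) xs 1"

lemma word_simps [simp]: "word e [] = 1" "word e (x # xs) = e x * word e xs"
  by (simp_all add: word_def)

lemma word_append: "word e (xs @ ys) = word e xs * word e ys"
  by (induction xs) (simp_all add: mult.assoc)

lemma clmono_word: "clmono e S = word e (sorted_list_of_set S)"
  by (simp add: clmono_def word_def)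

context
  fixes e :: "nat \<Rightarrow> 'c"
  assumes e_square: "\<And>i. i < n \<Longrightarrow> e i * e i = 1"
    and e_anticomm: "\<And>i j. i < n \<Longrightarrow> j < n \<Longrightarrow> i \<noteq> j \<Longrightarrow> e i * e j = - (e j * e i)"
    and e_span: "\<And>i. i < n \<Longrightarrow> gam i \<in> vec.span (e ` {..<n})"
begin

lemma e_cancel: "i < n \<Longrightarrow> e i * (e i * c) = c"
  by (simp add: mult.assoc[symmetric] e_square)

lemma e_swap: "i < n \<Longrightarrow> j < n \<Longrightarrow> i \<noteq> j \<Longrightarrow> e i * (e j * c) = - (e j * (e i * c))"
  using e_anticomm[of i j] by (simp add: mult.assoc[symmetric])

text \<open>Moving \<open>e i\<close> through the word costs a sign for each letter different from
  i. The number of these letters has the parity of the length plus the count of i, a form that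
  avoids subtraction.\<close>

lemma word_conj:
  assumes "i < n" "set xs \<subseteq> {..<n}"
  shows "e i * word e xs * e i = (if even (length xs + count_list xs i) then word e xs else - word e xs)"
  using assms(2)
proof (induction xs)
  case Nil
  then show ?case by (simp add: e_square assms(1))
next
  case (Cons x xs)
  then have IH: "e i * word e xs * e i = (if even (length xs + count_list xs i) then word e xs else - word e xs)"
    and x: "x < n"
    by simp_all
  show ?case
  proof (cases "x = i")
    case True
    have "e i * word e (x # xs) * e i = e i * (e i * word e xs * e i)"
      by (simp add: True mult.assoc)
    then show ?thesis
      unfolding IH by (simp add: True)
  next
    case False
    then have "e i * word e (x # xs) * e i = - (e x * (e i * word e xs * e i))"
      using e_swap[OF assms(1) x, of "word e xs"] by (simp add: mult.assoc)
    then show ?thesis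
      unfolding IH using False by simp
  qed
qed

lemma word_insort:
  assumes "i < n" "set xs \<subseteq> {..<n}" "i \<notin> set xs"
  shows "e i * word e xs = word e (insort i xs) \<or> e i * word e xs = - word e (insort i xs)"
  using assms(2,3)
proof (induction xs)
  case (Cons x xs)
  then have IH: "e i * word e xs = word e (insort i xs) \<or> e i * word e xs = - word e (insort i xs)"
    and x: "x < n" "i \<noteq> x"
    by auto
  then show ?case
    using e_swap[OF assms(1) x] by auto
qed simp

lemma word_remove1:
  assumes "i < n" "set xs \<subseteq> {..<n}" "i \<in> set xs"
  shows "e i * word e xs = word e (remove1 i xs) \<or> e i * word e xs = - word e (remove1 i xs)"
  using assms(2,3)
proof (induction xs)
  case (Cons x xs)
  show ?case
  proof (cases "x = i")
    case True
    then show ?thesis by (simp add: e_cancel assms(1))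
  next
    case False
    then have "e i * word e xs = word e (remove1 i xs) \<or> e i * word e xs = - word e (remove1 i xs)"
      and "x < n"
      using Cons by auto
    then show ?thesis
      using e_swap[OF assms(1) \<open>x < n\<close>] False by auto
  qed
qed simp

abbreviation "mono_span \<equiv> vec.span (clmono e ` Pow {..<n})"

lemma mono_span_base: "S \<subseteq> {..<n} \<Longrightarrow> clmono e S \<in> mono_span"
  by (intro vec.span_base) blast

text \<open>Left multiplication by \<open>e i\<close> toggles the membership of i in S, up to a
  sign.\<close>

lemma e_mult_clmono:
  assumes "i < n" "S \<subseteq> {..<n}"
  shows "e i * clmono e S \<in> mono_span"
proof -
  have fin: "finite S"
    using assms(2) finite_subset by blast
  obtain S' where S': "S' \<subseteq> {..<n}" "e i * clmono e S = clmono e S' \<or> e i * clmono e S = - clmono e S'"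
  proof (cases "i \<in> S")
    case True
    show thesis
    proof (rule that[of "S - {i}"])
      show "e i * clmono e S = clmono e (S - {i}) \<or> e i * clmono e S = - clmono e (S - {i})"
        unfolding clmono_word sorted_list_of_set_remove[OF fin]
        using assms True fin by (intro word_remove1) auto
    qed (use assms in blast)
  next
    case False
    show thesis
    proof (rule that[of "insert i S"])
      show "e i * clmono e S = clmono e (insert i S) \<or> e i * clmono e S = - clmono e (insert i S)"
        unfolding clmono_word sorted_list_of_set_insert[OF fin False]
        using assms False fin by (intro word_insort) auto
    qed (use assms in blast)
  qed
  then show ?thesis
    using mono_span_base[OF S'(1)] vec.span_neg[OF mono_span_base[OF S'(1)]] by auto
qed

text \<open>The span contains 1 and is stable under every \<open>e j\<close>, hence under the
  generators, which are combinations of the \<open>e j\<close>.\<close>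

lemma mono_span_UNIV: "c \<in> mono_span"
proof (induction c rule: Cl_induct)
  case one
  show ?case
    using mono_span_base[of "{}"] by (simp add: clmono_word)
next
  case (gen i a)
  have e: "e j * a \<in> mono_span" if "j < n" "a \<in> mono_span" for j a
    using that(2)
  proof (induction rule: vec.span_induct_alt)
    case (step c x y)
    then have "e j * x \<in> mono_span"
      using e_mult_clmono[OF that(1)] by blast
    then show ?case
      using step.IH by (simp add: distrib_left sc_left_commute[of "e j"] vec.span_add vec.span_scale)
  qed (simp add: vec.span_zero)
  show ?case
    using e_span[OF gen(1)]
  proof (induction rule: vec.span_induct_alt)
    case (step c x y)
    then have "x * a \<in> mono_span"
      using e gen(2) by auto
    then show ?case
      using step.IH by (simp add: distrib_right mult.assoc vec.span_add vec.span_scale)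
  qed (simp add: vec.span_zero)
next
  case (scale z a)
  then show ?case by (rule vec.span_scale)
next
  case (plus a b)
  then show ?case by (rule vec.span_add)
qed

lemma word_rev_cancel: "set xs \<subseteq> {..<n} \<Longrightarrow> word e (rev xs @ xs) = 1"
  by (induction xs) (simp_all add: word_append mult.assoc e_cancel)

lemma count_list_distinct: "distinct xs \<Longrightarrow> count_list xs i = (if i \<in> set xs then 1 else 0)"
  by (induction xs) auto

lemma ideal_contains_one:
  fixes J :: "'c set"
  assumes "even n" "cl_subrep J" "J \<noteq> {0}"
  shows "1 \<in> J"
proof -
  obtain c where c: "c \<in> J" "c \<noteq> 0"
    using assms(3) cl_subrepD(1)[OF assms(2)] by blast
  obtain k where k: "c = (\<Sum>S\<in>Pow {..<n}. sc (k S) * clmono e S)"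
    using span_family[OF _ mono_span_UNIV[of c]] by blast
  obtain T where T: "T \<in> Pow {..<n}" "k T \<noteq> 0"
  proof (rule ccontr)
    assume "\<not> thesis"
    then have "k S = 0" if "S \<in> Pow {..<n}" for S
      using that \<open>\<And>T. T \<in> Pow {..<n} \<Longrightarrow> k T \<noteq> 0 \<Longrightarrow> thesis\<close> by blast
    then have "c = 0"
      unfolding k by (intro sum.neutral) simp
    then show False using c(2) by simp
  qed
  \<comment> \<open>Left multiplication by the reversed monomial of a T with nonzero coefficient
    turns that term into a multiple of 1. The remaining terms become words that may repeat letters
    and are unsorted, which is why signs were computed for arbitrary lists.\<close>
  define L where "L S = rev (sorted_list_of_set T) @ sorted_list_of_set S" for S :: "nat set"
  have fin: "finite S" if "S \<in> Pow {..<n}" for S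
    using that finite_subset by auto
  have L: "set (L S) \<subseteq> {..<n}" "length (L S) = card T + card S"
    "count_list (L S) i = (if i \<in> T then 1 else 0) + (if i \<in> S then 1 else 0)"
    if "S \<in> Pow {..<n}" for S i
    using that T(1) fin[OF T(1)] fin[OF that] by (auto simp: L_def count_list_distinct)
  show ?thesis
  proof (rule ideal_extract_one[where w = "\<lambda>S. word e (L S)" and k = k and T = T and F = "Pow {..<n}",
      OF assms(2) e_square])
    show "word e (L T) = 1"
      unfolding L_def using T(1) fin[OF T(1)] by (intro word_rev_cancel) auto
    show "e i * word e (L S) * e i = word e (L S) \<or> e i * word e (L S) * e i = - word e (L S)"
      if "S \<in> Pow {..<n}" "i < n" for S i
      using word_conj[OF that(2) L(1)[OF that(1)]] by presburger
    show "\<exists>i<n. e i * word e (L S) * e i = - word e (L S)" if S: "S \<in> Pow {..<n}" "S \<noteq> T" for S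
    proof (rule ccontr)
      assume neg: "\<not> ?thesis"
      \<comment> \<open>If no conjugation negates the word of S, all the sign exponents are even.
        Hence i lies in both or neither of T and S for every i, or in exactly one of them for every
        i.\<close>
      have par: "even (card T + card S + ((if i \<in> T then 1 else 0) + (if i \<in> S then 1 else 0)))" if "i < n" for i
      proof (rule ccontr)
        assume odd: "\<not> ?thesis"
        have "e i * word e (L S) * e i = - word e (L S)"
          using word_conj[OF that L(1)[OF S(1)]] unfolding L(2,3)[OF S(1)] if_not_P[OF odd] .
        then show False
          using neg that by blast
      qed
      show False
      proof (cases "even (card T + card S)")
        case True
        then have "i \<in> T \<longleftrightarrow> i \<in> S" if "i < n" for i
          using par[OF that] by (auto split: if_splits)
        then show False
          using S T(1) by auto
      next
        \<comment> \<open>Here S is the complement of T, so the two sizes add up to n. Only this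
          case uses that n is even; for odd n the full product of the basis would not be separated
          from 1.\<close>
        case False
        then have "i \<in> T \<longleftrightarrow> i \<notin> S" if "i < n" for i
          using par[OF that] by (auto split: if_splits)
        then have "T \<union> S = {..<n}" "T \<inter> S = {}"
          using S(1) T(1) by auto
        then have "card T + card S = n"
          using card_Un_disjoint[OF fin[OF T(1)] fin[OF S(1)]] by simp
        then show False
          using False assms(1) by simp
      qed
    qed
    have "word e (rev (sorted_list_of_set T)) * c \<in> J"
      by (rule cl_subrepD(3)[OF assms(2) c(1)])
    then show "(\<Sum>S\<in>Pow {..<n}. sc (k S) * word e (L S)) \<in> J"
      unfolding k L_def word_append clmono_word sum_distrib_left
      by (simp only: sc_left_commute[of "word e (rev (sorted_list_of_set T))"])
  qed (use T in simp_all)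
qed

end

lemma Cl_simple:
  fixes J :: "'c set"
  assumes "even n" "cl_subrep J" "J \<noteq> {0}"
  shows "1 \<in> J"
proof -
  obtain B where B: "orthonormal B" "gam_span \<subseteq> vec.span B" "finite B" "card B = n"
    by (rule orthonormal_basis)
  obtain e where e: "bij_betw e {..<n} B"
    using ex_bij_betw_nat_finite[OF B(3)] B(4) by (auto simp: lessThan_atLeast0)
  have eB: "e i \<in> B" if "i < n" for i
    using e that by (auto simp: bij_betw_def)
  show ?thesis
  proof (rule ideal_contains_one[OF _ _ _ assms])
    show "e i * e i = 1" if "i < n" for i
      using B(1) eB[OF that] by (simp add: orthonormal_def)
    show "e i * e j = - (e j * e i)" if "i < n" "j < n" "i \<noteq> j" for i j
    proof -
      have "e i \<noteq> e j"
        using e that by (auto simp: bij_betw_def inj_on_def)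
      then have "e i * e j + e j * e i = 0"
        using B(1) eB that by (simp add: orthonormal_def)
      then show ?thesis
        by (simp add: eq_neg_iff_add_eq_0)
    qed
    show "gam i \<in> vec.span (e ` {..<n})" if "i < n" for i
      using B(2) vec.span_base[of "gam i" "gam ` {..<n}"] that e by (auto simp: bij_betw_def)
  qed
qed

end

theorem theorem7p5:
  fixes n :: nat and eta :: "nat \<Rightarrow> nat \<Rightarrow> complex"
    and sc :: "complex \<Rightarrow> 'c::ring_1" and gam :: "nat \<Rightarrow> 'c"
  assumes "1 \<le> n" and "n \<noteq> 2"
    and "\<forall>i<n. \<forall>j<n. eta i j = eta j i"
    and "\<exists>etainv. \<forall>i<n. \<forall>j<n. (\<Sum>k<n. eta i k * etainv k j) = (if i = j then 1 else 0)"
    and "is_Cl n eta sc gam"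
  shows "(\<forall>a\<in>Nrm n eta sc gam. \<forall>f\<in>Vplus n sc gam. a f \<in> Vplus n sc gam)
       \<and> (\<forall>a\<in>Iid n eta sc gam. \<forall>f\<in>Vplus n sc gam. a f = (\<lambda>_. 0))
       \<and> (\<forall>c. \<forall>f\<in>Vplus n sc gam. rop c f \<in> Vplus n sc gam)
       \<and> (\<forall>a\<in>Nrm n eta sc gam. \<forall>c. \<forall>f\<in>Vplus n sc gam. a (rop c f) = rop c (a f))
       \<and> bij_betw (\<lambda>W. {c. const c \<in> W}) {W. irred_subrep n eta sc gam W} {J. cl_irred J}
       \<and> (even n \<longrightarrow> irred_subrep n eta sc gam (Vplus n sc gam))"
proof -
  obtain etainv where inv:
    "\<forall>i<n. \<forall>j<n. (\<Sum>k<n. eta i k * etainv k j) = (if i = j then 1 else 0)"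
    using assms(4) by blast
  interpret dirac n eta etainv sc gam
    by standard (use assms(3,5) inv in simp_all)
  have "(\<lambda>W. {c. const c \<in> W}) = coef_ideal"
    by (simp add: fun_eq_iff coef_ideal_def)
  then have bij: "bij_betw (\<lambda>W. {c. const c \<in> W}) {W. irred W} {J. cl_irred J}"
    using bij_betw_irred[OF assms(2)] by simp
  show ?thesis
  proof (intro conjI ballI allI impI)
    show "a f \<in> Vp" if "a \<in> \<N>" "f \<in> Vp" for a f
      by (rule Nrm_V_plus[OF that])
    show "a f = (\<lambda>_. 0)" if "a \<in> \<I>" "f \<in> Vp" for a f
      using I_kills[OF that] by (simp only: zero_fun_def)
    show "rop c f \<in> Vp" if "f \<in> Vp" for c f
      by (rule rop_V_plus[OF that])
    show "a (rop c f) = rop c (a f)" if "a \<in> \<N>" for a c f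
      by (rule WC_rop[OF Nrm_WC[OF that]])
    show "irred Vp" if "even n"
      by (rule irred_Vp[OF assms(1,2) Cl_simple[OF that]])
  qed (rule bij)
qed

end
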